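(* Let $\mathfrak{R}=(D,\mathcal{M},\pi)$ be a matroid-rooted digraph with $D=(V,A)$, $\mathcal{M}=(S,\mathcal{I})$, let $t\in V$, let $T$ be the $\subseteq$-largest $t$-good set, and let $\mathcal{P}=\{P_i\}_{i\in I}$ be an $(I,\{t\})$-linkage (with $I\in\mathcal{I}$). If $\mathcal{P}$ and $T$ do not satisfy the complementarity conditions, then there is a $\{t\}$-linkable $I'\in\mathcal{I}$ with $\mathsf{span}(I')\supsetneq\mathsf{span}(I)$.
   Context: Matroids may be infinite (axioms of Bruhn et al.); $\mathsf{span}$ is the closure operator; a base of $S'\subseteq S$ is a base of the restriction to $S'$. Paths are finite directed paths without repeated vertices. A matroid-rooted digraph is $(D,\mathcal{M},\pi)$ with $D=(V,A)$ a digraph (parallel edges allowed, no loops), $\mathcal{M}=(S,\mathcal{I})$ a matroid, $\pi:S\to\mathcal{P}(V)\setminus\{\varnothing\}$. For $X\subseteq V$, $\mathcal{S}(X)=\{i\in S:\pi(i)\cap X\ne\varnothing\}$, $\mathsf{in}_D(X)$ is the set of edges entering $X$, $D[X]$ the induced subdigraph. For $I\in\mathcal{I}$ and $Y\subseteq V$ an $(I,Y)$-linkage is a family of pairwise edge-disjoint paths $\{P_i\}_{i\in I}$ with $P_i$ from a vertex of $\pi(i)$ to a vertex of $Y$; $I$ is $Y$-linkable if one exists. A set $X\subseteq V$ is $t$-good if there is a system of pairwise edge-disjoint paths $\{P_b\}_{b\in B}\cup\{P_e\}_{e\in\mathsf{in}_D(X)}$ in $D[X]$ with $B$ a base of $\mathcal{S}(X)$,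 $P_b$ from $\pi(b)$ to $t$, $P_e$ from $\mathsf{head}(e)$ to $t$; a $\subseteq$-largest $t$-good set exists. The complementarity conditions for an $(I,\{t\})$-linkage $\{P_i\}_{i\in I}$ and a vertex set $X\ni t$ are: (1) $I_{in}:=I\cap\mathcal{S}(X)$ is a base of $\mathcal{S}(X)$; (2) the paths $P_i$, $i\in I_{in}$, lie in $D[X]$; (3) for $i\in I_{out}:=I\setminus\mathcal{S}(X)$ we have $|A(P_i)\cap\mathsf{in}_D(X)|=1$; (4) $\bigcup_{i\in I_{out}}A(P_i)\supseteq\mathsf{in}_D(X)$. *)

theory Defs
  imports
    "Graph_Theory.Digraph"
    "Graph_Theory.Arc_Walk"
    "Graph_Theory.Digraph_Component"
    "HOL-Library.Disjoint_Sets"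
begin

definition incl_maximal :: "'s set set \<Rightarrow> 's set \<Rightarrow> bool" where
  "incl_maximal F B \<longleftrightarrow> B \<in> F \<and> (\<forall>J\<in>F. B \<subseteq> J \<longrightarrow> J = B)"

definition restrict_indep :: "'s set set \<Rightarrow> 's set \<Rightarrow> 's set set" where
  "restrict_indep \<I> X = {J \<in> \<I>. J \<subseteq> X}"

definition base_of :: "'s set set \<Rightarrow> 's set \<Rightarrow> 's set \<Rightarrow> bool" where
  "base_of \<I> X B \<longleftrightarrow> incl_maximal (restrict_indep \<I> X) B"

text \<open>
  Independence axioms (I1), (I2), (I3), (IM) of Bruhn, Diestel, Kriesell, Pendavingh and Wollan
  for matroids on a ground set of arbitrary cardinality.
\<close>

locale infinite_matroid =
  fixes S :: "'s set" and \<I> :: "'s set set"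
  assumes indep_subset_ground: "I \<in> \<I> \<Longrightarrow> I \<subseteq> S"
    and indep_empty: "{} \<in> \<I>"
    and indep_subset: "I \<in> \<I> \<Longrightarrow> J \<subseteq> I \<Longrightarrow> J \<in> \<I>"
    and indep_augment:
      "I \<in> \<I> \<Longrightarrow> \<not> incl_maximal \<I> I \<Longrightarrow> incl_maximal \<I> B \<Longrightarrow> \<exists>x\<in>B - I. insert x I \<in> \<I>"
    and indep_maximal:
      "I \<in> \<I> \<Longrightarrow> I \<subseteq> X \<Longrightarrow> X \<subseteq> S \<Longrightarrow> \<exists>M. incl_maximal {J \<in> \<I>. I \<subseteq> J \<and> J \<subseteq> X} M"

definition matroid_span :: "'s set \<Rightarrow> 's set set \<Rightarrow> 's set \<Rightarrow> 's set" where
  "matroid_span S \<I> X = X \<union> {x \<in> S. \<exists>J. J \<subseteq> X \<and> J \<in> \<I> \<and> insert x J \<notin> \<I>}"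

text \<open>The digraph locale used here allows parallel arcs and infinitely many vertices and arcs.\<close>

locale matroid_rooted_digraph =
  loopfree_digraph D + infinite_matroid S \<I>
  for D :: "('v, 'e) pre_digraph" and S :: "'s set" and \<I> :: "'s set set" +
  fixes \<pi> :: "'s \<Rightarrow> 'v set"
  assumes root_sub: "i \<in> S \<Longrightarrow> \<pi> i \<subseteq> verts D"
    and root_nonempty: "i \<in> S \<Longrightarrow> \<pi> i \<noteq> {}"

definition rooted_in :: "'s set \<Rightarrow> ('s \<Rightarrow> 'v set) \<Rightarrow> 'v set \<Rightarrow> 's set" where
  "rooted_in S \<pi> X = {i \<in> S. \<pi> i \<inter> X \<noteq> {}}"

definition entering :: "('v, 'e) pre_digraph \<Rightarrow> 'v set \<Rightarrow> 'e set" where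
  "entering D X = {e \<in> arcs D. tail D e \<notin> X \<and> head D e \<in> X}"

text \<open>
  A path is encoded by its first vertex and its list of arcs; the first vertex is
  needed for the trivial paths, whose arc list is empty.
\<close>

type_synonym ('v, 'e) dpath = "'v \<times> 'e awalk"

definition path_from_to ::
    "('v, 'e) pre_digraph \<Rightarrow> 'v set \<Rightarrow> ('v, 'e) dpath \<Rightarrow> 'v set \<Rightarrow> bool" where
  "path_from_to D U P Y \<longleftrightarrow> fst P \<in> U \<and> (\<exists>y\<in>Y. pre_digraph.apath D (fst P) (snd P) y)"

definition path_arcs :: "('v, 'e) dpath \<Rightarrow> 'e set" where
  "path_arcs P = set (snd P)"

definition path_verts :: "('v, 'e) pre_digraph \<Rightarrow> ('v, 'e) dpath \<Rightarrow> 'v set" where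
  "path_verts D P = set (pre_digraph.awalk_verts D (fst P) (snd P))"

definition linkage ::
    "('v, 'e) pre_digraph \<Rightarrow> ('s \<Rightarrow> 'v set) \<Rightarrow> 's set \<Rightarrow> 'v set \<Rightarrow> ('s \<Rightarrow> ('v, 'e) dpath) \<Rightarrow> bool" where
  "linkage D \<pi> I Y P \<longleftrightarrow>
     (\<forall>i\<in>I. path_from_to D (\<pi> i) (P i) Y) \<and> disjoint_family_on (\<lambda>i. path_arcs (P i)) I"

definition linkable ::
    "('v, 'e) pre_digraph \<Rightarrow> ('s \<Rightarrow> 'v set) \<Rightarrow> 's set \<Rightarrow> 'v set \<Rightarrow> bool" where
  "linkable D \<pi> I Y \<longleftrightarrow> (\<exists>P. linkage D \<pi> I Y P)"

text \<open>
  The path system of a good set is one family over the disjoint union of the base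
  and the set of entering arcs, so that disjointness is also required across the two kinds of paths.
\<close>

definition t_good ::
    "('v, 'e) pre_digraph \<Rightarrow> 's set \<Rightarrow> 's set set \<Rightarrow> ('s \<Rightarrow> 'v set) \<Rightarrow> 'v \<Rightarrow> 'v set \<Rightarrow> bool" where
  "t_good D S \<I> \<pi> t X \<longleftrightarrow> X \<subseteq> verts D \<and>
     (\<exists>B (P :: 's + 'e \<Rightarrow> ('v, 'e) dpath).
        base_of \<I> (rooted_in S \<pi> X) B \<and>
        (\<forall>b\<in>B. path_from_to (D \<restriction> X) (\<pi> b) (P (Inl b)) {t}) \<and>
        (\<forall>e\<in>entering D X. path_from_to (D \<restriction> X) {head D e} (P (Inr e)) {t}) \<and>
        disjoint_family_on (\<lambda>k. path_arcs (P k)) (B <+> entering D X))"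

definition largest_t_good ::
    "('v, 'e) pre_digraph \<Rightarrow> 's set \<Rightarrow> 's set set \<Rightarrow> ('s \<Rightarrow> 'v set) \<Rightarrow> 'v \<Rightarrow> 'v set \<Rightarrow> bool" where
  "largest_t_good D S \<I> \<pi> t T \<longleftrightarrow>
     t_good D S \<I> \<pi> t T \<and> (\<forall>X. t_good D S \<I> \<pi> t X \<longrightarrow> X \<subseteq> T)"

definition complementarity ::
    "('v, 'e) pre_digraph \<Rightarrow> 's set \<Rightarrow> 's set set \<Rightarrow> ('s \<Rightarrow> 'v set) \<Rightarrow>
     's set \<Rightarrow> ('s \<Rightarrow> ('v, 'e) dpath) \<Rightarrow> 'v set \<Rightarrow> bool" where
  "complementarity D S \<I> \<pi> I P X \<longleftrightarrow>
     (let I_in = I \<inter> rooted_in S \<pi> X; I_out = I - rooted_in S \<pi> X in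
        base_of \<I> (rooted_in S \<pi> X) I_in \<and>
        (\<forall>i\<in>I_in. path_verts D (P i) \<subseteq> verts (D \<restriction> X) \<and> path_arcs (P i) \<subseteq> arcs (D \<restriction> X)) \<and>
        (\<forall>i\<in>I_out. card (path_arcs (P i) \<inter> entering D X) = 1) \<and>
        entering D X \<subseteq> (\<Union>i\<in>I_out. path_arcs (P i)))"

end

theory Submission
  imports Defs
begin

text \<open>
  Let \<open>B\<close> and \<open>Q\<close> witness that \<open>T\<close> is good. Cutting every path of the linkage that starts outside \<open>T\<close>
  at its first arc into \<open>T\<close> and continuing along \<open>Q\<close> links an independent set \<open>B \<union> L\<close> spanning \<open>I\<close>.
  If it spans no more than \<open>I\<close>, the failure of complementarity leaves some arc entering \<open>T\<close> unused.
  Search backwards from this arc in the residual digraph, where besides the usual moves along arcs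
  one may exchange a root within a fundamental circuit. Either the search meets a root outside
  \<open>span (B \<union> L)\<close>, and a shortest residual walk yields an augmentation that changes only finitely many
  paths; or the set \<open>R\<close> of vertices reached makes \<open>T \<union> R\<close> good, contradicting the maximality of \<open>T\<close>.
\<close>

section \<open>Span and bases in infinite matroids\<close>

text \<open>Since \<open>I\<close>, the digraph and even fundamental circuits may be infinite, no
  ranks or flow values can be compared: progress is measured by \<open>span\<close> alone, and each
  rerouting must be confined to finitely many walks. A residual walk is finite, which makes this
  possible. Inside \<open>T\<close> nothing has to be rerouted. \<open>Q\<close> has one path for
  each element of \<open>B\<close> and one for each entering arc, and the tails of all its arcs lie
  in \<open>T\<close>, whereas the pieces outside use only arcs with tails outside \<open>T\<close>.
  So it suffices to find arc-disjoint walks up to the first arc into \<open>T\<close>; they end in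
  distinct entering arcs and extend along distinct paths of \<open>Q\<close>.
  \<open>B \<union> L\<close> is a base of \<open>B\<close> together with the roots of
  \<open>I\<close> outside \<open>T\<close>, hence spans \<open>I\<close>. If its span equals that
  of \<open>I\<close> and every entering arc is used, each linkage path contains at most one
  entering arc, \<open>L\<close> is the whole outer part of \<open>I\<close>, and exchanging
  \<open>B\<close> for another base shows that the inner part of \<open>I\<close> is a base. This is
  complementarity.\<close>

lemma base_ofD:
  assumes "base_of \<I> X B"
  shows "B \<in> \<I>" "B \<subseteq> X" "\<And>J. J \<in> \<I> \<Longrightarrow> J \<subseteq> X \<Longrightarrow> B \<subseteq> J \<Longrightarrow> J = B"
  using assms by (auto simp: base_of_def incl_maximal_def restrict_indep_def)

lemma base_ofI:
  assumes "B \<in> \<I>" "B \<subseteq> X" "\<And>J. J \<in> \<I> \<Longrightarrow> J \<subseteq> X \<Longrightarrow> B \<subseteq> J \<Longrightarrow> J = B"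
  shows "base_of \<I> X B"
  using assms by (auto simp: base_of_def incl_maximal_def restrict_indep_def)

context infinite_matroid
begin

abbreviation span :: "'s set \<Rightarrow> 's set" where
  "span \<equiv> matroid_span S \<I>"

lemma base_extending:
  assumes "I \<in> \<I>" "I \<subseteq> X" "X \<subseteq> S"
  obtains B where "base_of \<I> X B" "I \<subseteq> B"
proof -
  obtain B where B: "incl_maximal {J \<in> \<I>. I \<subseteq> J \<and> J \<subseteq> X} B"
    using indep_maximal[OF assms] by blast
  then have BI: "B \<in> \<I>" "B \<subseteq> X" and "I \<subseteq> B"
    and max: "\<And>J. J \<in> \<I> \<Longrightarrow> I \<subseteq> J \<Longrightarrow> J \<subseteq> X \<Longrightarrow> B \<subseteq> J \<Longrightarrow> J = B"
    by (auto simp: incl_maximal_def)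
  have "base_of \<I> X B"
    using max order_trans[OF \<open>I \<subseteq> B\<close>] by (intro base_ofI[OF BI]) simp
  then show thesis using \<open>I \<subseteq> B\<close> by (rule that)
qed

lemma base_of_insert_dependent:
  assumes "base_of \<I> X B" "x \<in> X" "x \<notin> B"
  shows "insert x B \<notin> \<I>"
  using base_ofD(2)[OF assms(1)] base_ofD(3)[OF assms(1), of "insert x B"] assms(2,3) by auto

lemma base_ofI_insert:
  assumes "B \<in> \<I>" "B \<subseteq> X" "\<And>x. x \<in> X \<Longrightarrow> x \<notin> B \<Longrightarrow> insert x B \<notin> \<I>"
  shows "base_of \<I> X B"
proof (rule base_ofI)
  fix J assume J: "J \<in> \<I>" "J \<subseteq> X" "B \<subseteq> J"
  show "J = B"
  proof (rule ccontr)
    assume "J \<noteq> B"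
    then obtain x where "x \<in> J" "x \<notin> B" using J by blast
    moreover have "insert x B \<in> \<I>" using indep_subset[OF J(1)] J(3) \<open>x \<in> J\<close> by blast
    ultimately show False using assms(3) J(2) by blast
  qed
qed (use assms in auto)

lemma global_base_iff: "incl_maximal \<I> B \<longleftrightarrow> base_of \<I> S B"
proof -
  have "restrict_indep \<I> S = \<I>" using indep_subset_ground by (auto simp: restrict_indep_def)
  then show ?thesis by (simp add: base_of_def)
qed

text \<open>Augmentation relative to \<open>X\<close>: extend \<open>insert y I\<close> to a base \<open>M\<close> of the matroid and \<open>B\<close> to
  a base \<open>B'\<close> inside \<open>B \<union> M\<close>; then augment \<open>M - {y}\<close> from \<open>B'\<close>.\<close>

lemma restricted_augment:
  assumes B: "base_of \<I> X B" and X: "X \<subseteq> S" and y: "insert y I \<in> \<I>" "insert y I \<subseteq> X" "y \<notin> I"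
  shows "\<exists>x\<in>B - I. insert x I \<in> \<I>"
proof -
  obtain M where M: "base_of \<I> S M" "insert y I \<subseteq> M"
    using base_extending[OF y(1)] indep_subset_ground[OF y(1)] by blast
  have MS: "M \<subseteq> S" "M \<in> \<I>" using base_ofD[OF M(1)] by auto
  have BS: "B \<in> \<I>" "B \<subseteq> X" using base_ofD[OF B] by auto
  obtain B' where B': "base_of \<I> (B \<union> M) B'" "B \<subseteq> B'"
    using base_extending[of B "B \<union> M"] BS X MS by blast
  have B'I: "B' \<in> \<I>" "B' \<subseteq> B \<union> M" using base_ofD[OF B'(1)] by auto
  have B'max: "incl_maximal \<I> B'"
  proof (rule ccontr)
    assume "\<not> incl_maximal \<I> B'"
    then obtain x where "x \<in> M - B'" "insert x B' \<in> \<I>"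
      using indep_augment[OF B'I(1)] M(1) global_base_iff by blast
    then show False using base_of_insert_dependent[OF B'(1)] by blast
  qed
  have "M - {y} \<in> \<I>" by (rule indep_subset[OF MS(2)]) blast
  moreover have "\<not> incl_maximal \<I> (M - {y})"
    using M(2) MS(2) unfolding incl_maximal_def by blast
  ultimately obtain x where x: "x \<in> B' - (M - {y})" "insert x (M - {y}) \<in> \<I>"
    using indep_augment[OF _ _ B'max] by blast
  \<comment> \<open>If \<open>x\<close> lies in \<open>M\<close>, then \<open>x = y\<close>, which
    lies in \<open>X\<close>. So \<open>x\<close> is in \<open>B\<close> or in
    \<open>B' \<inter> X\<close>, and the latter is \<open>B\<close> by maximality.\<close>
  have "B' \<inter> X = B"
    using base_ofD(3)[OF B, of "B' \<inter> X"] indep_subset[OF B'I(1), of "B' \<inter> X"] B'(2) BS(2) by auto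
  then have "x \<in> B" using x(1) B'I(2) y(2) by blast
  moreover have "x \<notin> I" using x(1) M(2) y(3) by blast
  moreover have "insert x I \<in> \<I>" by (rule indep_subset[OF x(2)]) (use M(2) y(3) in blast)
  ultimately show ?thesis by blast
qed

lemma span_superset: "X \<subseteq> span X"
  by (auto simp: matroid_span_def)

lemma span_mono: "X \<subseteq> Y \<Longrightarrow> span X \<subseteq> span Y"
  by (auto simp: matroid_span_def)

lemma span_subset_ground: "X \<subseteq> S \<Longrightarrow> span X \<subseteq> S"
  by (auto simp: matroid_span_def)

lemma indep_insert_iff:
  assumes "I \<in> \<I>" "x \<in> S" "x \<notin> I"
  shows "insert x I \<in> \<I> \<longleftrightarrow> x \<notin> span I"
proof
  assume ins: "insert x I \<in> \<I>"
  show "x \<notin> span I"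
    using assms indep_subset[OF ins insert_mono] unfolding matroid_span_def by auto
qed (use assms in \<open>auto simp: matroid_span_def\<close>)

lemma indep_not_in_span_remove:
  assumes "I \<in> \<I>" "x \<in> I"
  shows "x \<notin> span (I - {x})"
proof -
  have "insert x (I - {x}) = I" using assms by auto
  then show ?thesis
    using indep_insert_iff[of "I - {x}" x] indep_subset[of I "I - {x}"] indep_subset_ground assms
    by auto
qed

lemma base_of_span:
  assumes "I \<in> \<I>"
  shows "base_of \<I> (span I) I"
proof (rule base_ofI_insert[OF assms span_superset])
  fix x assume x: "x \<in> span I" "x \<notin> I"
  then have "x \<in> S" using span_subset_ground[OF indep_subset_ground[OF assms]] by auto
  then show "insert x I \<notin> \<I>" using indep_insert_iff[OF assms] x by auto
qed

text \<open>If \<open>x\<close> were spanned by \<open>X\<close> but not by \<open>B\<close>, a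
  witness \<open>J\<close> for \<open>x\<close> would extend to a base \<open>J'\<close> of
  \<open>X\<close> that is still a base of \<open>insert x X\<close>. As \<open>insert x B\<close>
  is independent, augmenting \<open>B\<close> from \<open>J'\<close> would then enlarge
  \<open>B\<close> inside \<open>X\<close>.\<close>

lemma span_base:
  assumes B: "base_of \<I> X B" and X: "X \<subseteq> S"
  shows "span X = span B"
proof
  show "span B \<subseteq> span X" using span_mono[OF base_ofD(2)[OF B]] .
  have BI: "B \<in> \<I>" "B \<subseteq> X" using base_ofD[OF B] by auto
  show "span X \<subseteq> span B"
  proof
    fix x assume x: "x \<in> span X"
    then have xS: "x \<in> S" using span_subset_ground[OF X] by auto
    show "x \<in> span B"
    proof (rule ccontr)
      assume nin: "x \<notin> span B"
      then have xB: "x \<notin> B" using span_superset[of B] by auto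
      have ins: "insert x B \<in> \<I>" using indep_insert_iff[OF BI(1) xS xB] nin by blast
      then have xX: "x \<notin> X" using base_of_insert_dependent[OF B _ xB] by blast
      then obtain J where J: "J \<subseteq> X" "J \<in> \<I>" "insert x J \<notin> \<I>"
        using x by (auto simp: matroid_span_def)
      obtain J' where J': "base_of \<I> X J'" "J \<subseteq> J'" using base_extending[OF J(2,1) X] .
      have J'I: "J' \<in> \<I>" "J' \<subseteq> X" using base_ofD[OF J'(1)] by auto
      have "insert x J' \<notin> \<I>" using J(3) indep_subset[OF _ insert_mono[OF J'(2)]] by auto
      then have "base_of \<I> (insert x X) J'"
        using J'I base_of_insert_dependent[OF J'(1)] by (intro base_ofI_insert) auto
      then obtain z where "z \<in> J' - B" "insert z B \<in> \<I>"
        using restricted_augment[of "insert x X" J' x B] ins X xS BI xB by auto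
      then show False using base_of_insert_dependent[OF B] J'I by blast
    qed
  qed
qed

text \<open>Idempotence of closure: \<open>I\<close> is a base of \<open>span I\<close>, and a base
  spans everything that its set spans.\<close>

lemma span_least:
  assumes "I \<in> \<I>" "X \<subseteq> span I"
  shows "span X \<subseteq> span I"
  using span_mono[OF assms(2)] span_base[OF base_of_span[OF assms(1)]]
    span_subset_ground[OF indep_subset_ground[OF assms(1)]] by simp

lemma base_of_spans:
  assumes "base_of \<I> X B" "X \<subseteq> S"
  shows "X \<subseteq> span B"
  using span_base[OF assms] span_superset[of X] by simp

lemma base_ofI_span:
  assumes "B \<in> \<I>" "B \<subseteq> X" "X \<subseteq> span B"
  shows "base_of \<I> X B"
proof (rule base_ofI_insert[OF assms(1,2)])
  fix x assume x: "x \<in> X" "x \<notin> B"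
  then show "insert x B \<notin> \<I>"
    using base_of_insert_dependent[OF base_of_span[OF assms(1)]] assms(3) by auto
qed

text \<open>The hypotheses place \<open>j\<close> on the fundamental circuit of \<open>s\<close>, or
  make \<open>s = j\<close>. The dependence of \<open>insert s K\<close>, read from the side of
  \<open>j\<close>, puts \<open>j\<close> into the span of the new set.\<close>

lemma exchange:
  assumes K: "K \<in> \<I>" "j \<in> K" and s: "s \<in> span K" "s \<notin> span (K - {j})"
  shows "insert s (K - {j}) \<in> \<I>" "K \<subseteq> span (insert s (K - {j}))"
proof -
  have sS: "s \<in> S" using s span_subset_ground[OF indep_subset_ground[OF K(1)]] by auto
  have sK: "s \<notin> K - {j}" using s(2) span_superset[of "K - {j}"] by auto
  have KI: "K - {j} \<in> \<I>" by (rule indep_subset[OF K(1)]) blast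
  show ins: "insert s (K - {j}) \<in> \<I>" using indep_insert_iff[OF KI sS sK] s(2) by blast
  have "j \<in> span (insert s (K - {j}))"
  proof (cases "s = j")
    case False
    then have "s \<notin> K" using sK by blast
    then have "insert s K \<notin> \<I>" using indep_insert_iff[OF K(1) sS] s(1) by auto
    moreover have "insert s K = insert j (insert s (K - {j}))" using K(2) by blast
    ultimately show ?thesis
      using indep_insert_iff[OF ins, of j] indep_subset_ground K False by auto
  qed (use span_superset[of "insert s (K - {j})"] in auto)
  then show "K \<subseteq> span (insert s (K - {j}))"
    using span_superset[of "insert s (K - {j})"] by blast
qed

text \<open>The elements \<open>x\<close> of \<open>I\<close> with \<open>s \<notin> span (I - {x})\<close> form the fundamental circuit of \<open>s\<close> without
  \<open>s\<close> itself; the point is that they already span \<open>s\<close> although \<open>I\<close> may be infinite.\<close>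

lemma span_fundamental:
  assumes I: "I \<in> \<I>" and s: "s \<in> span I" and C: "{x \<in> I. s \<notin> span (I - {x})} \<subseteq> C" "C \<subseteq> I"
  shows "s \<in> span C"
proof (cases "s \<in> I")
  case True
  then show ?thesis using indep_not_in_span_remove[OF I True] C span_superset[of C] by auto
next
  case False
  have sS: "s \<in> S" using s span_subset_ground[OF indep_subset_ground[OF I]] by auto
  have sIS: "insert s I \<subseteq> S" using sS indep_subset_ground[OF I] by auto
  have dep: "insert s I \<notin> \<I>" using indep_insert_iff[OF I sS False] s by blast
  have CI: "C \<in> \<I>" by (rule indep_subset[OF I C(2)])
  show ?thesis
  proof (rule ccontr)
    assume "s \<notin> span C"
    then have "insert s C \<in> \<I>" using indep_insert_iff[OF CI sS] False C by blast
    then obtain M where M: "base_of \<I> (insert s I) M" "insert s C \<subseteq> M"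
      using base_extending[of "insert s C" "insert s I"] C sIS by blast
    have MI: "M \<in> \<I>" "M \<subseteq> insert s I" using base_ofD[OF M(1)] by auto
    \<comment> \<open>Some \<open>y\<close> of \<open>I\<close> is missing from \<open>M\<close>.
      Augmenting \<open>I - {y}\<close> from \<open>M\<close> can only add \<open>s\<close>, so
      \<open>y\<close> belongs to the fundamental circuit and hence to
      \<open>C \<subseteq> M\<close>, a contradiction.\<close>
    have "M \<noteq> insert s I" using dep MI(1) by blast
    then obtain y where y: "y \<in> I" "y \<notin> M" using M(2) MI(2) by blast
    have "insert y (I - {y}) = I" using y by blast
    then obtain x where x: "x \<in> M - (I - {y})" "insert x (I - {y}) \<in> \<I>"
      using restricted_augment[OF M(1) sIS, of y "I - {y}"] I by auto
    then have "x = s" using MI y by blast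
    then have "s \<notin> span (I - {y})"
      using x indep_insert_iff[OF indep_subset[OF I, of "I - {y}"] sS] by auto
    then show False using C y M(2) by blast
  qed
qed

text \<open>Independence over \<open>X\<close>, as in a contraction, does not depend on the chosen
  base of \<open>X\<close>: a base of \<open>B' \<union> L\<close> that missed some \<open>k\<close>
  in \<open>L\<close> would lie in the span of \<open>B \<union> L - {k}\<close> and yet span
  \<open>k\<close>.\<close>

lemma base_exchange_independent:
  assumes X: "X \<subseteq> S" and B: "base_of \<I> X B" "base_of \<I> X B'"
    and L: "B \<union> L \<in> \<I>" "L \<inter> X = {}"
  shows "B' \<union> L \<in> \<I>"
proof -
  have BX: "B \<subseteq> X" "B' \<subseteq> X" "B' \<in> \<I>" using base_ofD[OF B(1)] base_ofD[OF B(2)] by auto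
  have "B' \<union> L \<subseteq> S" using BX X indep_subset_ground[OF L(1)] by blast
  then obtain M where M: "base_of \<I> (B' \<union> L) M" "B' \<subseteq> M"
    using base_extending[of B' "B' \<union> L"] BX by blast
  have MI: "M \<in> \<I>" "M \<subseteq> B' \<union> L" using base_ofD[OF M(1)] by auto
  have False if k: "k \<in> L" "k \<notin> M" for k
  proof -
    have BL: "(B \<union> L) - {k} \<in> \<I>" by (rule indep_subset[OF L(1)]) blast
    have kX: "k \<notin> X" using k L by blast
    have "B \<subseteq> (B \<union> L) - {k}" using kX BX by blast
    then have "X \<subseteq> span ((B \<union> L) - {k})"
      using base_of_spans[OF B(1) X] span_mono by (meson order_trans)
    then have "M \<subseteq> span ((B \<union> L) - {k})"
      using MI(2) BX(2) k(2) span_superset[of "(B \<union> L) - {k}"] by blast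
    then have "span M \<subseteq> span ((B \<union> L) - {k})" using span_least[OF BL] by blast
    moreover have "k \<in> span M"
      using base_of_spans[OF M(1) \<open>B' \<union> L \<subseteq> S\<close>] k by blast
    ultimately show False using indep_not_in_span_remove[OF L(1)] k by blast
  qed
  then have "B' \<union> L = M" using M(2) MI(2) by blast
  then show ?thesis using MI by simp
qed

end

section \<open>Walks up to their first entrance into a vertex set\<close>

text \<open>The empty list is excluded so that the last arc always enters \<open>T\<close> and
  thereby selects the path of \<open>Q\<close> that continues the walk. Vertices may repeat;
  shortening to a path is left to the moment of extension.\<close>

fun entry_walk :: "('v, 'e) pre_digraph \<Rightarrow> 'v set \<Rightarrow> 'v \<Rightarrow> 'e list \<Rightarrow> bool" where
  "entry_walk D T u [] \<longleftrightarrow> False"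
| "entry_walk D T u (e # p) \<longleftrightarrow> e \<in> arcs D \<and> tail D e = u \<and> u \<notin> T \<and>
     (if p = [] then head D e \<in> T else entry_walk D T (head D e) p)"

lemma entry_walk_start: "entry_walk D T u p \<Longrightarrow> u \<notin> T \<and> p \<noteq> [] \<and> tail D (hd p) = u"
  by (cases p) auto

lemma entry_walk_arc: "entry_walk D T u p \<Longrightarrow> f \<in> set p \<Longrightarrow> f \<in> arcs D \<and> tail D f \<notin> T"
  by (induction p arbitrary: u) (auto split: if_splits)

lemma entry_walk_last: "entry_walk D T u p \<Longrightarrow> last p \<in> set p \<and> last p \<in> entering D T"
  by (induction p arbitrary: u) (auto split: if_splits simp: entering_def)

lemma entry_walk_head_in:
  "entry_walk D T u p \<Longrightarrow> f \<in> set p \<Longrightarrow> head D f \<in> T \<Longrightarrow> f = last p"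
  by (induction p arbitrary: u) (auto split: if_splits dest: entry_walk_start)

lemma entry_walk_suffix:
  "entry_walk D T u (p @ q) \<Longrightarrow> q \<noteq> [] \<Longrightarrow> entry_walk D T (tail D (hd q)) q"
  by (induction p arbitrary: u) (auto split: if_splits dest: entry_walk_start)

lemma entry_walk_cas: "entry_walk D T u p \<Longrightarrow> pre_digraph.cas D u p (head D (last p))"
  by (induction p arbitrary: u) (auto split: if_splits simp: pre_digraph.cas.simps)

text \<open>A head lies in \<open>T\<close> only at the end of the walk, so every inner head that is
  in \<open>R \<union> T\<close> is in \<open>R\<close>.\<close>

lemma entry_walk_tails_closed:
  assumes "entry_walk D T u p" "u \<in> R" "\<And>f. f \<in> set p \<Longrightarrow> tail D f \<in> R \<Longrightarrow> head D f \<in> R \<union> T"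
  shows "f \<in> set p \<Longrightarrow> tail D f \<in> R"
  using assms
proof (induction p arbitrary: u)
  case (Cons e p)
  show ?case
  proof (cases "f = e")
    case False
    then have f: "f \<in> set p" and ew: "entry_walk D T (head D e) p"
      using Cons.prems by (auto split: if_splits)
    have "head D e \<in> R" using Cons.prems(2-4) entry_walk_start[OF ew] by auto
    then show ?thesis using Cons.IH[OF f ew] Cons.prems(4) by auto
  qed (use Cons.prems in auto)
qed simp

lemma ex_entry_prefix:
  assumes "pre_digraph.cas D u p y" "set p \<subseteq> arcs D" "u \<notin> T" "y \<in> T"
  shows "\<exists>a q. p = a @ q \<and> entry_walk D T u a"
  using assms
proof (induction p arbitrary: u)
  case Nil
  then show ?case by (simp add: pre_digraph.cas.simps)
next
  case (Cons e p)
  show ?case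
  proof (cases "head D e \<in> T")
    case True
    then have "e # p = [e] @ p \<and> entry_walk D T u [e]"
      using Cons.prems by (auto simp: pre_digraph.cas.simps)
    then show ?thesis by blast
  next
    case False
    then obtain a q where aq: "p = a @ q" "entry_walk D T (head D e) a"
      using Cons.IH[of "head D e"] Cons.prems by (auto simp: pre_digraph.cas.simps)
    then have "e # p = (e # a) @ q \<and> entry_walk D T u (e # a)"
      using Cons.prems by (auto simp: pre_digraph.cas.simps)
    then show ?thesis by blast
  qed
qed

text \<open>Backwards from the end in \<open>T\<close>, the last arc with its tail outside
  \<open>T\<close> would be an entering arc.\<close>

lemma walk_without_entering_arc:
  assumes "pre_digraph.cas D u p y" "set p \<subseteq> arcs D" "y \<in> T" "set p \<inter> entering D T = {}"
  shows "set (pre_digraph.awalk_verts D u p) \<subseteq> T \<and> u \<in> T \<and> (\<forall>f\<in>set p. tail D f \<in> T \<and> head D f \<in> T)"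
  using assms
proof (induction p arbitrary: u)
  case (Cons e p)
  then have "set (pre_digraph.awalk_verts D (head D e) p) \<subseteq> T \<and> head D e \<in> T \<and>
      (\<forall>f\<in>set p. tail D f \<in> T \<and> head D f \<in> T)"
    by (auto simp: pre_digraph.cas.simps)
  moreover have "tail D e \<in> T" using calculation Cons.prems by (auto simp: entering_def)
  ultimately show ?case using Cons.prems
    by (auto simp: pre_digraph.cas.simps pre_digraph.awalk_verts.simps)
qed (simp add: pre_digraph.cas.simps pre_digraph.awalk_verts.simps)

lemma cas_induce_subgraph: "pre_digraph.cas (D \<restriction> X) u p v = pre_digraph.cas D u p v"
  by (induction p arbitrary: u) (auto simp: pre_digraph.cas.simps)

context wf_digraph
begin

text \<open>The concatenation may repeat vertices and is shortened to a path. Only an inclusion of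
  arc sets is recorded, since it is enough to preserve arc-disjointness.\<close>

lemma apath_induce_append:
  assumes a: "cas u a v" "set a \<subseteq> arcs (G \<restriction> X)" and u: "u \<in> X"
    and q: "pre_digraph.apath (G \<restriction> T) v q t" and TX: "T \<subseteq> X"
  shows "\<exists>p. pre_digraph.apath (G \<restriction> X) u p t \<and> set p \<subseteq> set a \<union> set q"
proof -
  interpret X: wf_digraph "G \<restriction> X" by (rule wellformed_induce_subgraph)
  have q': "set q \<subseteq> arcs (G \<restriction> T)" "pre_digraph.cas (G \<restriction> T) v q t"
    using q unfolding pre_digraph.apath_def pre_digraph.awalk_def by auto
  have qX: "set q \<subseteq> arcs (G \<restriction> X)" using q'(1) TX by auto
  have "X.cas u a v" "X.cas v q t" using a(1) q'(2) unfolding cas_induce_subgraph by auto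
  moreover have "v \<in> X"
    using q TX unfolding pre_digraph.apath_def pre_digraph.awalk_def by auto
  ultimately have w: "X.awalk u (a @ q) t"
    using a(2) qX u by (intro X.awalk_appendI[of u a v]) (simp_all add: X.awalk_def)
  show ?thesis
    using X.apath_awalk_to_apath[OF w] X.awalk_to_apath_subset[OF w] by auto
qed

lemma apath_induce_mono:
  assumes "pre_digraph.apath (G \<restriction> T) v q t" "T \<subseteq> X"
  shows "\<exists>p. pre_digraph.apath (G \<restriction> X) v p t \<and> set p \<subseteq> set q"
proof -
  have "v \<in> X" using assms unfolding pre_digraph.apath_def pre_digraph.awalk_def by auto
  then show ?thesis using apath_induce_append[of v "[]" v X T q t] assms by auto
qed

end

section \<open>Decomposing a finite flow into walks\<close>

definition excess ::
    "('v, 'e) pre_digraph \<Rightarrow> 'e set \<Rightarrow> 's set \<Rightarrow> ('s \<Rightarrow> 'v) \<Rightarrow> 'v \<Rightarrow> int" where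
  "excess D F K \<sigma> v =
     (\<Sum>f\<in>F. of_bool (tail D f = v) - of_bool (head D f = v)) - (\<Sum>k\<in>K. of_bool (\<sigma> k = v))"

lemma excess_insert_arc:
  "finite F \<Longrightarrow> f \<notin> F \<Longrightarrow>
   excess D (insert f F) K \<sigma> v = excess D F K \<sigma> v + of_bool (tail D f = v) - of_bool (head D f = v)"
  by (simp add: excess_def)

lemma excess_remove_arc:
  "finite F \<Longrightarrow> f \<in> F \<Longrightarrow>
   excess D (F - {f}) K \<sigma> v = excess D F K \<sigma> v - of_bool (tail D f = v) + of_bool (head D f = v)"
  by (simp add: excess_def sum_diff1)

lemma excess_remove_start:
  "finite K \<Longrightarrow> k \<in> K \<Longrightarrow>
   excess D F (K - {k}) \<sigma> v = excess D F K \<sigma> v + of_bool (\<sigma> k = v)"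
  by (simp add: excess_def sum_diff1 del: sum_of_bool_eq)

lemma excess_insert_start:
  assumes "finite K" "k \<notin> K"
  shows "excess D F (insert k K) (\<sigma>(k := u)) v = excess D F K \<sigma> v - of_bool (u = v)"
proof -
  have "(\<Sum>i\<in>K. of_bool ((\<sigma>(k := u)) i = v)) = (\<Sum>i\<in>K. of_bool (\<sigma> i = v) :: int)"
    using assms by (intro sum.cong) (auto simp del: sum_of_bool_eq)
  then show ?thesis using assms by (simp add: excess_def del: sum_of_bool_eq)
qed

lemma excess_move_start:
  assumes "finite K" "k \<in> K"
  shows "excess D F K (\<sigma>(k := u)) v = excess D F K \<sigma> v + of_bool (\<sigma> k = v) - of_bool (u = v)"
proof -
  have "K = insert k (K - {k})" using assms by blast
  then show ?thesis
    using excess_insert_start[of "K - {k}" k D F \<sigma> u v] excess_remove_start[OF assms, of D F \<sigma> v]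
      assms by simp
qed

text \<open>Nonnegative excess at the start of \<open>k\<close> forces an arc of \<open>F\<close> to
  leave it. Deleting this arc while moving the start of \<open>k\<close> to its head, or finishing
  \<open>k\<close> if the head lies in \<open>T\<close>, leaves the excess outside \<open>T\<close>
  unchanged, so the induction runs on the number of arcs.\<close>

lemma flow_decomposition:
  assumes "finite F" "finite K" "\<And>f. f \<in> F \<Longrightarrow> f \<in> arcs D \<and> tail D f \<notin> T"
    and "\<And>k. k \<in> K \<Longrightarrow> \<sigma> k \<notin> T" "\<And>v. v \<notin> T \<Longrightarrow> 0 \<le> excess D F K \<sigma> v"
  shows "\<exists>a. (\<forall>k\<in>K. entry_walk D T (\<sigma> k) (a k) \<and> set (a k) \<subseteq> F) \<and>
           disjoint_family_on (\<lambda>k. set (a k)) K"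
  using assms
proof (induction "card F" arbitrary: F K \<sigma> rule: less_induct)
  case less
  note F = less.prems(1) and K = less.prems(2) and arc = less.prems(3)
    and start = less.prems(4) and exc = less.prems(5)
  show ?case
  proof (cases "K = {}")
    case True
    then show ?thesis by (auto simp: disjoint_family_on_def)
  next
    case False
    then obtain k where k: "k \<in> K" by blast
    have "\<exists>f\<in>F. tail D f = \<sigma> k"
    proof (rule ccontr)
      assume "\<not> ?thesis"
      then have "(\<Sum>f\<in>F. of_bool (tail D f = \<sigma> k) - of_bool (head D f = \<sigma> k)) \<le> (0 :: int)"
        by (intro sum_nonpos) auto
      moreover have "(1 :: int) \<le> (\<Sum>i\<in>K. of_bool (\<sigma> i = \<sigma> k))"
        using member_le_sum[of k K "\<lambda>i. of_bool (\<sigma> i = \<sigma> k) :: int"] k K by simp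
      ultimately have "excess D F K \<sigma> (\<sigma> k) < 0" unfolding excess_def by linarith
      then show False using exc[OF start[OF k]] by linarith
    qed
    then obtain f where f: "f \<in> F" "tail D f = \<sigma> k" by blast
    have smaller: "card (F - {f}) < card F" using F f by (meson card_Diff1_less)
    show ?thesis
    proof (cases "head D f \<in> T")
      case True
      have "\<exists>a. (\<forall>i\<in>K - {k}. entry_walk D T (\<sigma> i) (a i) \<and> set (a i) \<subseteq> F - {f}) \<and>
           disjoint_family_on (\<lambda>i. set (a i)) (K - {k})"
      proof (rule less.hyps[OF smaller])
        fix v assume v: "v \<notin> T"
        then show "0 \<le> excess D (F - {f}) (K - {k}) \<sigma> v"
          using exc[OF v] f k F K True by (auto simp: excess_remove_arc excess_remove_start)
      qed (use F K arc start in auto)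
      then obtain a where a: "\<forall>i\<in>K - {k}. entry_walk D T (\<sigma> i) (a i) \<and> set (a i) \<subseteq> F - {f}"
        "disjoint_family_on (\<lambda>i. set (a i)) (K - {k})" by blast
      have "disjoint_family_on (\<lambda>i. set ((a(k := [f])) i)) K"
        using a unfolding disjoint_family_on_def by (auto split: if_splits)
      moreover have "\<forall>i\<in>K. entry_walk D T (\<sigma> i) ((a(k := [f])) i) \<and> set ((a(k := [f])) i) \<subseteq> F"
        using a f arc[OF f(1)] True by auto
      ultimately show ?thesis by blast
    next
      case False
      have "\<exists>a. (\<forall>i\<in>K. entry_walk D T ((\<sigma>(k := head D f)) i) (a i) \<and> set (a i) \<subseteq> F - {f}) \<and>
           disjoint_family_on (\<lambda>i. set (a i)) K"
      proof (rule less.hyps[OF smaller])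
        fix v assume v: "v \<notin> T"
        then show "0 \<le> excess D (F - {f}) K (\<sigma>(k := head D f)) v"
          using exc[OF v] f k F K by (auto simp: excess_remove_arc excess_move_start)
      qed (use F K arc start False in auto)
      then obtain a where a:
        "\<forall>i\<in>K. entry_walk D T ((\<sigma>(k := head D f)) i) (a i) \<and> set (a i) \<subseteq> F - {f}"
        "disjoint_family_on (\<lambda>i. set (a i)) K" by blast
      have "disjoint_family_on (\<lambda>i. set ((a(k := f # a k)) i)) K"
      proof (unfold disjoint_family_on_def, intro ballI impI)
        fix m n assume mn: "m \<in> K" "n \<in> K" "m \<noteq> n"
        have "set (a m) \<inter> set (a n) = {}" using disjoint_family_onD[OF a(2) mn] .
        moreover have "f \<notin> set (a m)" "f \<notin> set (a n)" using a(1) mn by auto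
        ultimately show "set ((a(k := f # a k)) m) \<inter> set ((a(k := f # a k)) n) = {}"
          using mn(3) by auto
      qed
      moreover have "\<forall>i\<in>K. entry_walk D T (\<sigma> i) ((a(k := f # a k)) i) \<and> set ((a(k := f # a k)) i) \<subseteq> F"
        using a f k arc[OF f(1)] by (auto split: if_splits dest: entry_walk_start)
      ultimately show ?thesis by blast
    qed
  qed
qed

text \<open>The sum telescopes, and the final head does not count because it lies in
  \<open>T\<close>. Distinctness lets the sum over the set of arcs stand for the sum along the
  walk.\<close>

lemma entry_walk_excess:
  assumes "entry_walk D T u p" "distinct p" "v \<notin> T"
  shows "(\<Sum>f\<in>set p. of_bool (tail D f = v) - of_bool (head D f = v)) = (of_bool (u = v) :: int)"
  using assms
proof (induction p arbitrary: u)
  case (Cons e p)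
  then show ?case by (cases "p = []") auto
qed simp

lemma excess_entry_walks:
  assumes J: "finite J" and a: "\<And>j. j \<in> J \<Longrightarrow> entry_walk D T (u j) (a j) \<and> distinct (a j)"
    and dis: "disjoint_family_on (\<lambda>j. set (a j)) J" and v: "v \<notin> T"
  shows "excess D (\<Union>j\<in>J. set (a j)) J u v = 0"
proof -
  have "(\<Sum>f\<in>(\<Union>j\<in>J. set (a j)). of_bool (tail D f = v) - of_bool (head D f = v))
      = (\<Sum>j\<in>J. \<Sum>f\<in>set (a j). of_bool (tail D f = v) - of_bool (head D f = v) :: int)"
    using J dis by (intro sum.UNION_disjoint) (auto simp: disjoint_family_on_def)
  also have "\<dots> = (\<Sum>j\<in>J. of_bool (u j = v))"
    using a v by (intro sum.cong entry_walk_excess) auto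
  finally show ?thesis by (simp add: excess_def)
qed

section \<open>Linkages behind a good set\<close>

lemma path_from_to_unfold:
  "path_from_to D U p {t} \<longleftrightarrow> fst p \<in> U \<and> pre_digraph.apath D (fst p) (snd p) t"
  by (simp add: path_from_to_def)

lemma rooted_in_subset: "rooted_in S \<pi> X \<subseteq> S"
  by (auto simp: rooted_in_def)

locale good_set = matroid_rooted_digraph D S \<I> \<pi>
  for D :: "('v, 'e) pre_digraph" and S :: "'s set" and \<I> :: "'s set set"
    and \<pi> :: "'s \<Rightarrow> 'v set" +
  fixes t :: 'v and T :: "'v set" and B :: "'s set" and Q :: "'s + 'e \<Rightarrow> ('v, 'e) dpath"
  assumes T_verts: "T \<subseteq> verts D"
    and B_base: "base_of \<I> (rooted_in S \<pi> T) B"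
    and Q_root: "b \<in> B \<Longrightarrow> path_from_to (D \<restriction> T) (\<pi> b) (Q (Inl b)) {t}"
    and Q_entering: "e \<in> entering D T \<Longrightarrow> path_from_to (D \<restriction> T) {head D e} (Q (Inr e)) {t}"
    and Q_disjoint: "disjoint_family_on (\<lambda>k. path_arcs (Q k)) (B <+> entering D T)"
begin

lemma Q_arcs:
  assumes "k \<in> B <+> entering D T" "f \<in> path_arcs (Q k)"
  shows "tail D f \<in> T"
proof -
  have "path_arcs (Q k) \<subseteq> arcs (D \<restriction> T)"
    using assms(1) Q_root Q_entering
    unfolding path_from_to_unfold path_arcs_def pre_digraph.apath_def pre_digraph.awalk_def
    by blast
  then show ?thesis using assms(2) by auto
qed

text \<open>Each path consists of an outer piece \<open>O' k\<close> and arcs of the single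
  \<open>Q\<close>-path chosen by \<open>q k\<close>. Injectivity of \<open>q\<close> separates the
  \<open>Q\<close>-pieces from each other, and the position of the tails separates outer pieces from
  \<open>Q\<close>-pieces.\<close>

lemma disjoint_family_extending_Q:
  assumes sub: "\<And>k. k \<in> M \<Longrightarrow> path_arcs (P k) \<subseteq> O' k \<union> path_arcs (Q (q k))"
    and q: "inj_on q M" "\<And>k. k \<in> M \<Longrightarrow> q k \<in> B <+> entering D T"
    and O: "disjoint_family_on O' M" "\<And>k f. k \<in> M \<Longrightarrow> f \<in> O' k \<Longrightarrow> tail D f \<notin> T"
  shows "disjoint_family_on (\<lambda>k. path_arcs (P k)) M"
  unfolding disjoint_family_on_def
proof (intro ballI impI)
  fix k l assume kl: "k \<in> M" "l \<in> M" "k \<noteq> l"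
  have "q k \<noteq> q l" using q(1) kl by (auto dest: inj_onD)
  then have "path_arcs (Q (q k)) \<inter> path_arcs (Q (q l)) = {}"
    using disjoint_family_onD[OF Q_disjoint q(2)[OF kl(1)] q(2)[OF kl(2)]] by blast
  moreover have "O' k \<inter> O' l = {}" using disjoint_family_onD[OF O(1) kl] .
  moreover have "O' k \<inter> path_arcs (Q (q l)) = {}" "O' l \<inter> path_arcs (Q (q k)) = {}"
    using O(2)[OF kl(1)] O(2)[OF kl(2)] Q_arcs[OF q(2)[OF kl(1)]] Q_arcs[OF q(2)[OF kl(2)]] by auto
  ultimately show "path_arcs (P k) \<inter> path_arcs (P l) = {}"
    using sub[OF kl(1)] sub[OF kl(2)] by blast
qed

text \<open>The set \<open>X\<close> is left open because two cases are needed: all vertices, for a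
  linkage in \<open>D\<close>, and an enlargement of \<open>T\<close>, for the paths of a new good
  set.\<close>

lemma entry_walk_extends:
  assumes w: "entry_walk D T u p" and X: "T \<subseteq> X" "\<And>f. f \<in> set p \<Longrightarrow> tail D f \<in> X"
  shows "\<exists>r. pre_digraph.apath (D \<restriction> X) u r t \<and> set r \<subseteq> set p \<union> path_arcs (Q (Inr (last p)))"
proof -
  have heads: "head D f \<in> X" if "f \<in> set p" for f
    using that w X
  proof (induction p arbitrary: u)
    case (Cons e p)
    show ?case
    proof (cases "p = []")
      case False
      then have ew: "entry_walk D T (head D e) p" using Cons.prems by auto
      then have "head D e = tail D (hd p)" "hd p \<in> set p"
        using entry_walk_start False by force+
      then show ?thesis using Cons ew by (metis list.set_intros(2) set_ConsD)
    qed (use Cons.prems in auto)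
  qed simp
  have "last p \<in> entering D T" using entry_walk_last[OF w] by blast
  then have q: "pre_digraph.apath (D \<restriction> T) (head D (last p)) (snd (Q (Inr (last p)))) t"
    using Q_entering[of "last p"] by (auto simp: path_from_to_unfold)
  have "set p \<subseteq> arcs (D \<restriction> X)" using heads X(2) entry_walk_arc[OF w] by auto
  moreover have "u \<in> X" using entry_walk_start[OF w] X(2)[of "hd p"] by auto
  ultimately show ?thesis
    using apath_induce_append[OF entry_walk_cas[OF w] _ _ q X(1)] by (simp add: path_arcs_def)
qed

text \<open>A good set asks for a path from the head of an entering arc, so the walk must be
  followed from its second vertex on. If nothing remains after \<open>f\<close>, that vertex is
  already in \<open>T\<close> and is no start of an entry walk.\<close>

lemma entry_walk_tl_extends:
  assumes w: "entry_walk D T (tail D f) (f # p)" and X: "T \<subseteq> X" "\<And>g. g \<in> set p \<Longrightarrow> tail D g \<in> X"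
  shows "\<exists>r. pre_digraph.apath (D \<restriction> X) (head D f) r t \<and>
           set r \<subseteq> set p \<union> path_arcs (Q (Inr (last (f # p))))"
proof (cases "p = []")
  case True
  then have "f \<in> entering D T" using entry_walk_last[OF w] by simp
  then have "pre_digraph.apath (D \<restriction> T) (head D f) (snd (Q (Inr f))) t"
    using Q_entering[of f] by (auto simp: path_from_to_unfold)
  then show ?thesis using apath_induce_mono[OF _ X(1)] True by (simp add: path_arcs_def)
next
  case False
  then show ?thesis using entry_walk_extends[of "head D f" p X] w X by simp
qed

lemma apath_induceD:
  assumes "X \<subseteq> verts D" "pre_digraph.apath (D \<restriction> X) u p v"
  shows "apath u p v"
  using subgraph_apath_imp_apath[OF assms(2)] induced_imp_subgraph[OF induced_induce[OF assms(1)]]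
  by blast

lemma inj_on_last_entry_walk:
  assumes "\<And>k. k \<in> K \<Longrightarrow> entry_walk D T (u k) (a k)" "disjoint_family_on (\<lambda>k. set (a k)) K"
  shows "inj_on (\<lambda>k. last (a k)) K"
proof (rule inj_onI)
  fix k l assume kl: "k \<in> K" "l \<in> K" "last (a k) = last (a l)"
  then have "last (a k) \<in> set (a k) \<inter> set (a l)"
    using entry_walk_last[OF assms(1)] by (metis IntI)
  then show "k = l" using disjoint_family_onD[OF assms(2) kl(1,2)] by blast
qed

text \<open>Roots in \<open>B\<close> keep their own \<open>Q\<close>-paths; the other walks end in
  distinct entering arcs and take over the \<open>Q\<close>-paths of these arcs.\<close>

lemma linkable_entry_walks:
  assumes K: "K \<inter> B = {}" "\<And>k. k \<in> K \<Longrightarrow> u k \<in> \<pi> k"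
    and a: "\<And>k. k \<in> K \<Longrightarrow> entry_walk D T (u k) (a k)" "disjoint_family_on (\<lambda>k. set (a k)) K"
  shows "linkable D \<pi> (B \<union> K) {t}"
proof -
  have "\<forall>k\<in>K. \<exists>r. apath (u k) r t \<and> set r \<subseteq> set (a k) \<union> path_arcs (Q (Inr (last (a k))))"
  proof
    fix k assume k: "k \<in> K"
    have "tail D f \<in> verts D" if "f \<in> set (a k)" for f
      using entry_walk_arc[OF a(1)[OF k] that] by simp
    then show "\<exists>r. apath (u k) r t \<and> set r \<subseteq> set (a k) \<union> path_arcs (Q (Inr (last (a k))))"
      using entry_walk_extends[OF a(1)[OF k] T_verts] apath_induceD[OF subset_refl] by blast
  qed
  then obtain r where r: "\<And>k. k \<in> K \<Longrightarrow> apath (u k) (r k) t"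
    "\<And>k. k \<in> K \<Longrightarrow> set (r k) \<subseteq> set (a k) \<union> path_arcs (Q (Inr (last (a k))))" by metis
  define P where "P k = (if k \<in> B then Q (Inl k) else (u k, r k))" for k
  define A where "A k = (if k \<in> B then {} else set (a k))" for k
  define q where "q k = (if k \<in> B then Inl k else Inr (last (a k)) :: 's + 'e)" for k
  have "disjoint_family_on (\<lambda>k. path_arcs (P k)) (B \<union> K)"
  proof (rule disjoint_family_extending_Q[where O' = A and q = q])
    show "inj_on q (B \<union> K)"
      using inj_on_last_entry_walk[OF a] unfolding inj_on_def q_def by auto
    show "disjoint_family_on A (B \<union> K)"
      using a(2) unfolding disjoint_family_on_def A_def by auto
  next
    fix k assume k: "k \<in> B \<union> K"
    then show "path_arcs (P k) \<subseteq> A k \<union> path_arcs (Q (q k))"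
      using r(2) by (auto simp: P_def A_def q_def path_arcs_def)
    show "q k \<in> B <+> entering D T"
      using k entry_walk_last[OF a(1)] by (auto simp: q_def)
    show "tail D f \<notin> T" if "f \<in> A k" for f
      using that k entry_walk_arc[OF a(1)] by (auto simp: A_def split: if_splits)
  qed
  moreover have "path_from_to D (\<pi> k) (P k) {t}" if k: "k \<in> B \<union> K" for k
  proof (cases "k \<in> B")
    case True
    then show ?thesis
      using Q_root[OF True] apath_induceD[OF T_verts] by (simp add: P_def path_from_to_unfold)
  next
    case False
    then show ?thesis using k K r by (simp add: P_def path_from_to_unfold)
  qed
  ultimately show ?thesis unfolding linkable_def linkage_def by blast
qed

end

section \<open>The residual digraph and the enlargement of a good set\<close>

locale entry_linkage = good_set D S \<I> \<pi> t T B Q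
  for D :: "('v, 'e) pre_digraph" and S :: "'s set" and \<I> :: "'s set set"
    and \<pi> :: "'s \<Rightarrow> 'v set" and t T B Q +
  fixes L :: "'s set" and u :: "'s \<Rightarrow> 'v" and a :: "'s \<Rightarrow> 'e list"
  assumes indep: "B \<union> L \<in> \<I>" and L_B: "L \<inter> B = {}"
    and u_root: "j \<in> L \<Longrightarrow> u j \<in> \<pi> j"
    and a_walk: "j \<in> L \<Longrightarrow> entry_walk D T (u j) (a j)"
    and a_distinct: "j \<in> L \<Longrightarrow> distinct (a j)"
    and a_disjoint: "disjoint_family_on (\<lambda>j. set (a j)) L"
begin

definition used_arcs :: "'e set" where
  "used_arcs = (\<Union>j\<in>L. set (a j))"

text \<open>The backward residual relation: if besides the linkage there is a spare walk from \<open>v\<close> into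
  \<open>T\<close>, then after rerouting there is one from \<open>w\<close>.\<close>

definition residual_step :: "'v \<Rightarrow> 'v \<Rightarrow> bool" where
  "residual_step v w \<longleftrightarrow> w \<notin> T \<and>
     ((\<exists>f\<in>arcs D - used_arcs. tail D f = w \<and> head D f = v) \<or>
      (\<exists>j\<in>L. \<exists>f\<in>set (a j). tail D f = v \<and> head D f = w) \<or>
      (\<exists>j\<in>L. \<exists>s\<in>S. v \<in> \<pi> s \<and> u j = w \<and> s \<notin> span (B \<union> L - {j})))"

text \<open>Targets of the backward search: a spare walk from such a vertex can serve the new root
  \<open>s\<close>, which enlarges the span.\<close>

definition exposed :: "'v \<Rightarrow> bool" where
  "exposed v \<longleftrightarrow> (\<exists>s\<in>S. v \<in> \<pi> s \<and> s \<notin> span (B \<union> L))"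

text \<open>Each residual move yields one property of \<open>R\<close>. An arc with head in
  \<open>R\<close> that enters \<open>T \<union> R\<close> is used; a walk of the linkage that has
  reached \<open>R\<close> stays there until it enters \<open>T\<close>; and the fundamental circuit
  of a root seen from \<open>R\<close> lies in \<open>B \<union> J\<close>, up to the root itself.
  So \<open>B \<union> J\<close> is a base, and the walks of \<open>J\<close> together with the
  remainders of walks behind the entering arcs supply the paths.\<close>

lemma t_good_residual_closed:
  assumes R: "R \<subseteq> verts D - T"
    and closed: "\<And>v w. v \<in> R \<Longrightarrow> residual_step v w \<Longrightarrow> w \<in> R"
    and unexposed: "\<And>v. v \<in> R \<Longrightarrow> \<not> exposed v"
  shows "t_good D S \<I> \<pi> t (T \<union> R)"
proof -
  let ?X = "T \<union> R"
  define J where "J = {j \<in> L. u j \<in> R}"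
  have JL: "J \<subseteq> L" by (auto simp: J_def)
  have head_closed: "head D f \<in> R \<union> T" if "j \<in> L" "f \<in> set (a j)" "tail D f \<in> R" for j f
    using closed[of "tail D f" "head D f"] that unfolding residual_step_def by blast
  have J_tails: "tail D f \<in> R" if j: "j \<in> J" and f: "f \<in> set (a j)" for j f
    using entry_walk_tails_closed[of D T "u j" "a j" R f] head_closed[of j] a_walk[of j] j f
    by (simp add: J_def)
  have suffix_tails: "tail D g \<in> R"
    if j: "j \<in> L" "a j = p @ f # l" and f: "head D f \<in> R" and g: "g \<in> set l" for j p f l g
  proof -
    have ew: "entry_walk D T (tail D f) (f # l)"
      using entry_walk_suffix[of D T "u j" p "f # l"] a_walk[OF j(1)] j(2) by simp
    then have "entry_walk D T (head D f) l" using g by (auto split: if_splits)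
    then show ?thesis
      using entry_walk_tails_closed[of D T "head D f" l R g] head_closed[OF j(1)] f g j(2) by simp
  qed
  have base: "base_of \<I> (rooted_in S \<pi> ?X) (B \<union> J)"
  proof (rule base_ofI_span)
    show "B \<union> J \<in> \<I>" by (rule indep_subset[OF indep]) (use JL in blast)
    have "J \<subseteq> S" using JL indep_subset_ground[OF indep] by blast
    then show "B \<union> J \<subseteq> rooted_in S \<pi> ?X"
      using base_ofD(2)[OF B_base] u_root by (auto simp: J_def rooted_in_def)
    show "rooted_in S \<pi> ?X \<subseteq> span (B \<union> J)"
    proof
      fix s assume s: "s \<in> rooted_in S \<pi> ?X"
      then have sS: "s \<in> S" by (simp add: rooted_in_def)
      have BT: "rooted_in S \<pi> T \<subseteq> span B" using base_of_spans[OF B_base rooted_in_subset] .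
      show "s \<in> span (B \<union> J)"
      proof (cases "s \<in> rooted_in S \<pi> T")
        case True
        then show ?thesis using BT span_mono[of B "B \<union> J"] by auto
      next
        case False
        then obtain v where v: "v \<in> R" "v \<in> \<pi> s" using s by (auto simp: rooted_in_def)
        then have sspan: "s \<in> span (B \<union> L)" using unexposed sS by (auto simp: exposed_def)
        show ?thesis
        proof (rule span_fundamental[OF indep sspan])
          show "B \<union> J \<subseteq> B \<union> L" using JL by blast
          show "{x \<in> B \<union> L. s \<notin> span (B \<union> L - {x})} \<subseteq> B \<union> J"
          proof clarify
            fix x assume x: "x \<in> L" "x \<notin> J" "s \<notin> span (B \<union> L - {x})"
            have "u x \<notin> T" using entry_walk_start[OF a_walk[OF x(1)]] by blast
            then have "residual_step v (u x)" using x v sS unfolding residual_step_def by blast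
            then show "x \<in> B" using closed v(1) x by (auto simp: J_def)
          qed
        qed
      qed
    qed
  qed
  \<comment> \<open>If the head of \<open>f\<close> is in \<open>T\<close>, the
    \<open>Q\<close>-path of \<open>f\<close> alone suffices and \<open>l\<close> is empty.
    Otherwise \<open>f\<close> lies on some walk \<open>a j\<close>, and \<open>l\<close> is the
    rest of that walk.\<close>
  have "\<forall>f\<in>entering D ?X. \<exists>l. entry_walk D T (tail D f) (f # l) \<and>
      (l = [] \<or> head D f \<in> R \<and> (\<exists>j\<in>L. \<exists>p. a j = p @ f # l))"
  proof
    fix f assume f: "f \<in> entering D ?X"
    show "\<exists>l. entry_walk D T (tail D f) (f # l) \<and>
      (l = [] \<or> head D f \<in> R \<and> (\<exists>j\<in>L. \<exists>p. a j = p @ f # l))"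
    proof (cases "head D f \<in> T")
      case True
      then have "entry_walk D T (tail D f) [f]" using f by (auto simp: entering_def)
      then show ?thesis by blast
    next
      case False
      then have hf: "head D f \<in> R" and tf: "tail D f \<notin> ?X" "f \<in> arcs D"
        using f by (auto simp: entering_def)
      then have "f \<in> used_arcs"
        using closed[OF hf, of "tail D f"] unfolding residual_step_def by blast
      then obtain j p l where jpl: "j \<in> L" "a j = p @ f # l"
        by (auto simp: used_arcs_def in_set_conv_decomp)
      then have "entry_walk D T (tail D f) (f # l)"
        using entry_walk_suffix[of D T "u j" p "f # l"] a_walk[OF jpl(1)] by simp
      then show ?thesis using hf jpl by blast
    qed
  qed
  then obtain l where l_walk: "\<And>f. f \<in> entering D ?X \<Longrightarrow> entry_walk D T (tail D f) (f # l f)"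
    and l_suffix: "\<And>f. f \<in> entering D ?X \<Longrightarrow>
      l f = [] \<or> head D f \<in> R \<and> (\<exists>j\<in>L. \<exists>p. a j = p @ f # l f)"
    by metis
  have l_tails: "tail D g \<in> R" if "f \<in> entering D ?X" "g \<in> set (l f)" for f g
    using l_suffix[OF that(1)] suffix_tails that(2) by fastforce
  have l_used: "\<exists>j\<in>L. f \<in> set (a j) \<and> g \<in> set (a j)"
    if fg: "f \<in> entering D ?X" "g \<in> set (l f)" for f g
  proof -
    obtain j p where "j \<in> L" "a j = p @ f # l f" using l_suffix[OF fg(1)] fg(2) by auto
    then show ?thesis using fg(2) by (intro bexI[of _ j]) auto
  qed
  have J_not_entering: "f \<notin> set (a j)" if "j \<in> J" "f \<in> entering D ?X" for j f
    using J_tails that by (auto simp: entering_def)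
  \<comment> \<open>The arc \<open>f\<close> is kept although its path starts at its head: then
    \<open>last\<close> names the arc into \<open>T\<close> even if \<open>l f\<close> is empty, and
    disjointness of the walks makes these last arcs differ, so that \<open>q\<close> is
    injective.\<close>
  define w where "w k = (case k of Inl i \<Rightarrow> (if i \<in> B then [] else a i) | Inr f \<Rightarrow> f # l f)" for k
  define q where
    "q k = (case k of Inl i \<Rightarrow> if i \<in> B then Inl i else Inr (last (a i)) | Inr f \<Rightarrow> Inr (last (f # l f)))"
    for k :: "'s + 'e"
  let ?M = "(B \<union> J) <+> entering D ?X"
  have w_disjoint: "disjoint_family_on (\<lambda>k. set (w k)) ?M"
  proof -
    \<comment> \<open>Two remainders with a common arc belong to the same walk, on which one of
      \<open>f\<close>, \<open>g\<close> comes behind the other. Its tail is then in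
      \<open>R\<close>, so it does not enter \<open>T \<union> R\<close>.\<close>
    have ll: False if f: "f \<in> entering D ?X" and g: "g \<in> entering D ?X" and ne: "f \<noteq> g"
      and x: "x \<in> set (f # l f)" "x \<in> set (g # l g)" for f g x
    proof -
      have tails: "tail D f \<notin> R" "tail D g \<notin> R" using f g by (auto simp: entering_def)
      then have xl: "x \<in> set (l f)" "x \<in> set (l g)"
        using x l_tails[OF f] l_tails[OF g] ne by auto
      then obtain j p where j: "j \<in> L" "head D f \<in> R" "a j = p @ f # l f"
        using l_suffix[OF f] by auto
      obtain i p' where i: "i \<in> L" "head D g \<in> R" "a i = p' @ g # l g"
        using xl l_suffix[OF g] by auto
      have "x \<in> set (a j) \<inter> set (a i)" using xl j i by simp
      then have "i = j" using disjoint_family_onD[OF a_disjoint j(1) i(1)] by blast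
      then have "p @ f # l f = p' @ g # l g" using j i by simp
      then obtain us where "p = p' @ us \<and> us @ f # l f = g # l g \<or> p @ us = p' \<and> f # l f = us @ g # l g"
        by (auto simp: append_eq_append_conv2)
      then have "f \<in> set (l g) \<or> g \<in> set (l f)"
        using ne by (cases us) (auto dest: sym[where s = "_ @ _"])
      then show False using l_tails f g tails by auto
    qed
    have jl: False if j: "j \<in> J" and f: "f \<in> entering D ?X"
      and x: "x \<in> set (a j)" "x \<in> set (f # l f)" for j f x
    proof (cases "x = f")
      case True
      then show False using J_not_entering j f x by blast
    next
      case False
      then obtain i where i: "i \<in> L" "f \<in> set (a i)" "x \<in> set (a i)"
        using l_used[OF f] x by auto
      then have "i = j" using disjoint_family_onD[OF a_disjoint, of i j] j JL x by blast
      then show False using J_not_entering j f i by blast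
    qed
    have jj: "set (a i) \<inter> set (a j) = {}" if "i \<in> J" "j \<in> J" "i \<noteq> j" for i j
      using disjoint_family_onD[OF a_disjoint, of i j] that JL by blast
    show ?thesis
      unfolding disjoint_family_on_def
    proof (intro ballI impI)
      fix k k' assume kk: "k \<in> ?M" "k' \<in> ?M" "k \<noteq> k'"
      show "set (w k) \<inter> set (w k') = {}"
      proof (cases k)
        case (Inl i)
        show ?thesis
        proof (cases k')
          case (Inl i')
          then show ?thesis using kk \<open>k = Inl i\<close> jj[of i i'] by (auto simp: w_def)
        next
          case (Inr f)
          then show ?thesis using kk \<open>k = Inl i\<close> jl[of i f] by (auto simp: w_def)
        qed
      next
        case (Inr f)
        show ?thesis
        proof (cases k')
          case (Inl i')
          then show ?thesis using kk \<open>k = Inr f\<close> jl[of i' f] by (auto simp: w_def)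
        next
          case (Inr g)
          then show ?thesis using kk \<open>k = Inr f\<close> ll[of f g] by (auto simp: w_def)
        qed
      qed
    qed
  qed
  have w_walk: "\<exists>v. entry_walk D T v (w k)" and q_last: "q k = Inr (last (w k))"
    if "k \<in> ?M" "k \<notin> Inl ` B" for k
    using that a_walk JL l_walk by (auto simp: w_def q_def split: sum.split)
  have q_inj: "inj_on q ?M"
  proof (rule inj_onI)
    fix k k' assume kk: "k \<in> ?M" "k' \<in> ?M" "q k = q k'"
    show "k = k'"
    proof (cases "k \<in> Inl ` B \<or> k' \<in> Inl ` B")
      case True
      then show ?thesis using kk by (auto simp: q_def split: sum.splits if_splits)
    next
      case False
      then have "last (w k) = last (w k')" using kk q_last by auto
      moreover have "last (w k) \<in> set (w k)" "last (w k') \<in> set (w k')"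
        using w_walk entry_walk_last kk False by metis+
      ultimately show ?thesis using disjoint_family_onD[OF w_disjoint kk(1,2)] by auto
    qed
  qed
  have "\<forall>k\<in>?M. \<exists>P. path_from_to (D \<restriction> ?X) (case k of Inl i \<Rightarrow> \<pi> i | Inr f \<Rightarrow> {head D f}) P {t} \<and>
      path_arcs P \<subseteq> set (w k) \<union> path_arcs (Q (q k))" (is "\<forall>k\<in>?M. \<exists>P. ?ok k P")
  proof
    fix k assume k: "k \<in> ?M"
    show "\<exists>P. ?ok k P"
    proof (cases k)
      case (Inl i)
      show ?thesis
      proof (cases "i \<in> B")
        case True
        obtain r where "pre_digraph.apath (D \<restriction> ?X) (fst (Q (Inl i))) r t"
          "set r \<subseteq> set (snd (Q (Inl i)))"
          using apath_induce_mono[of T _ _ t ?X] Q_root[OF True]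
          unfolding path_from_to_unfold by blast
        then have "?ok k (fst (Q (Inl i)), r)"
          using Q_root[OF True] True Inl by (auto simp: path_from_to_unfold path_arcs_def q_def)
        then show ?thesis by blast
      next
        case False
        then have i: "i \<in> J" "i \<in> L" using k Inl JL by auto
        obtain r where "pre_digraph.apath (D \<restriction> ?X) (u i) r t"
          "set r \<subseteq> set (a i) \<union> path_arcs (Q (Inr (last (a i))))"
          using entry_walk_extends[OF a_walk[OF i(2)], of ?X] J_tails[OF i(1)] by blast
        then have "?ok k (u i, r)"
          using u_root[OF i(2)] False Inl by (simp add: path_from_to_unfold path_arcs_def q_def w_def)
        then show ?thesis by blast
      qed
    next
      case (Inr f)
      then have f: "f \<in> entering D ?X" using k by auto
      obtain r where "pre_digraph.apath (D \<restriction> ?X) (head D f) r t"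
        "set r \<subseteq> set (l f) \<union> path_arcs (Q (Inr (last (f # l f))))"
        using entry_walk_tl_extends[OF l_walk[OF f], of ?X] l_tails[OF f] by blast
      then have "?ok k (head D f, r)"
        using Inr by (auto simp: path_from_to_unfold path_arcs_def q_def w_def)
      then show ?thesis by blast
    qed
  qed
  then obtain P where P: "\<And>k. k \<in> ?M \<Longrightarrow> ?ok k (P k)" by metis
  have "disjoint_family_on (\<lambda>k. path_arcs (P k)) ?M"
  proof (rule disjoint_family_extending_Q[where O' = "\<lambda>k. set (w k)" and q = q])
    fix k assume k: "k \<in> ?M"
    show "path_arcs (P k) \<subseteq> set (w k) \<union> path_arcs (Q (q k))" using P[OF k] by blast
    show "q k \<in> B <+> entering D T"
    proof (cases "k \<in> Inl ` B")
      case False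
      then show ?thesis using w_walk[OF k] q_last[OF k] entry_walk_last by fastforce
    qed (auto simp: q_def)
    show "tail D f \<notin> T" if f: "f \<in> set (w k)" for f
    proof (cases "k \<in> Inl ` B")
      case False
      then show ?thesis using w_walk[OF k] entry_walk_arc f by metis
    qed (use f in \<open>auto simp: w_def\<close>)
  qed (fact q_inj w_disjoint)+
  moreover have "\<forall>b\<in>B \<union> J. path_from_to (D \<restriction> ?X) (\<pi> b) (P (Inl b)) {t}"
    using P[of "Inl b" for b] by auto
  moreover have "\<forall>e\<in>entering D ?X. path_from_to (D \<restriction> ?X) {head D e} (P (Inr e)) {t}"
    using P[of "Inr e" for e] by auto
  moreover have "?X \<subseteq> verts D" using R T_verts by blast
  ultimately show ?thesis unfolding t_good_def using base by blast
qed

end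

section \<open>Augmentation along a shortest residual walk\<close>

text \<open>The length is minimised over all targets satisfying \<open>P\<close>, not just for
  \<open>y\<close>; this is what excludes \<open>P\<close> at the earlier vertices.\<close>

lemma shortest_chain:
  assumes "(x, y) \<in> R\<^sup>*" "P y"
  obtains n v where "v 0 = x" "P (v n)" "\<And>i. i < n \<Longrightarrow> (v i, v (Suc i)) \<in> R"
    and "\<And>i. i < n \<Longrightarrow> \<not> P (v i)"
    and "\<And>i k. i < k \<Longrightarrow> k \<le> n \<Longrightarrow> v i \<noteq> v k"
    and "\<And>i k. Suc i < k \<Longrightarrow> k \<le> n \<Longrightarrow> (v i, v k) \<notin> R"
proof -
  define reach where "reach n \<longleftrightarrow> (\<exists>y. (x, y) \<in> R ^^ n \<and> P y)" for n
  define n where "n = (LEAST n. reach n)"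
  have "\<exists>n. reach n" using assms by (auto simp: reach_def rtrancl_power)
  then have "reach n" unfolding n_def by (rule LeastI_ex)
  then obtain v where v: "v 0 = x" "P (v n)" "\<And>i. i < n \<Longrightarrow> (v i, v (Suc i)) \<in> R"
    unfolding reach_def relpow_fun_conv by blast
  have minimal: "n \<le> m" if "(x, v k) \<in> R ^^ m" "P (v k)" for m k
    using that unfolding n_def reach_def by (intro Least_le) blast
  have seg: "(v i, v k) \<in> R ^^ (k - i)" if "i \<le> k" "k \<le> n" for i k
    unfolding relpow_fun_conv using that v(3) by (intro exI[of _ "\<lambda>l. v (i + l)"]) auto
  have pre: "(x, v i) \<in> R ^^ i" if "i \<le> n" for i using seg[of 0 i] that v(1) by simp
  show thesis
  proof (rule that[OF v])
    show "\<not> P (v i)" if "i < n" for i using minimal[OF pre, of i] that by auto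
    show "v i \<noteq> v k" if ik: "i < k" "k \<le> n" for i k
    proof
      assume "v i = v k"
      then have "(x, v n) \<in> R ^^ (i + (n - k))"
        using pre[of i] seg[of k n] ik unfolding relpow_add by auto
      then show False using minimal[OF _ v(2)] ik by fastforce
    qed
    show "(v i, v k) \<notin> R" if ik: "Suc i < k" "k \<le> n" for i k
    proof
      assume "(v i, v k) \<in> R"
      then have "(x, v k) \<in> R ^^ Suc i" using pre[of i] ik by auto
      then have "(x, v n) \<in> R ^^ (Suc i + (n - k))"
        using seg[of k n] ik unfolding relpow_add by blast
      then show False using minimal[OF _ v(2)] ik by fastforce
    qed
  qed
qed

context entry_linkage
begin

text \<open>A shortest residual walk from a spare entering arc to an exposed vertex is followed step by
  step. Only the finitely many walks it touches are replaced by the finite arc set \<open>F\<close>, regarded as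
  a flow with starts \<open>\<sigma> k\<close> for \<open>k \<in> K\<close>, and the current vertex keeps one unit of excess. Since there
  are no shortcuts, every later step remains possible after the earlier modifications.\<close>

lemma augment_along_residual_walk:
  assumes e0: "e0 \<in> entering D T" "e0 \<notin> used_arcs"
    and reach: "residual_step\<^sup>*\<^sup>* (tail D e0) y" and y: "exposed y"
  shows "\<exists>I'\<in>\<I>. linkable D \<pi> I' {t} \<and> span (B \<union> L) \<subset> span I'"
proof -
  have "(tail D e0, y) \<in> {(v, w). residual_step v w}\<^sup>*"
    using reach by (simp add: rtranclp_rtrancl_eq[symmetric])
  then obtain n v where v0: "v 0 = tail D e0" and vn: "exposed (v n)"
    and step: "\<And>i. i < n \<Longrightarrow> residual_step (v i) (v (Suc i))"
    and unexposed: "\<And>i. i < n \<Longrightarrow> \<not> exposed (v i)"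
    and inj: "\<And>i k. i < k \<Longrightarrow> k \<le> n \<Longrightarrow> v i \<noteq> v k"
    and no_shortcut: "\<And>i k. Suc i < k \<Longrightarrow> k \<le> n \<Longrightarrow> \<not> residual_step (v i) (v k)"
    by (rule shortest_chain[of _ _ _ exposed]) (use y in auto)
  have vT: "v m \<notin> T" if "m \<le> n" for m
    using that v0 e0(1) step unfolding residual_step_def entering_def by (cases m) auto
  have fresh: "v k \<notin> v ` {..<m}" if "m \<le> k" "k \<le> n" for m k
    using inj that by (metis imageE lessThan_iff order_less_le_trans)
  have "\<forall>m. \<exists>j. m < n \<longrightarrow>
      (\<exists>f\<in>arcs D - used_arcs. tail D f = v (Suc m) \<and> head D f = v m) \<or>
      j \<in> L \<and> (\<exists>f\<in>set (a j). tail D f = v m \<and> head D f = v (Suc m)) \<or>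
      j \<in> L \<and> (\<exists>s\<in>S. v m \<in> \<pi> s \<and> u j = v (Suc m) \<and> s \<notin> span (B \<union> L - {j}))"
    using step unfolding residual_step_def by blast
  then obtain w where w: "\<And>m. m < n \<Longrightarrow>
      (\<exists>f\<in>arcs D - used_arcs. tail D f = v (Suc m) \<and> head D f = v m) \<or>
      w m \<in> L \<and> (\<exists>f\<in>set (a (w m)). tail D f = v m \<and> head D f = v (Suc m)) \<or>
      w m \<in> L \<and> (\<exists>s\<in>S. v m \<in> \<pi> s \<and> u (w m) = v (Suc m) \<and> s \<notin> span (B \<union> L - {w m}))"
    by metis
  define J where "J = w ` {..<n} \<inter> L"
  define G where "G = B \<union> (L - J)"
  define F0 where "F0 = insert e0 (\<Union>j\<in>J. set (a j))"
  have JL: "J \<subseteq> L" and finJ: "finite J" by (auto simp: J_def)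
  have GL: "G \<subseteq> B \<union> L" by (auto simp: G_def)
  have wJ: "w m \<in> J" if "m < n" "w m \<in> L" for m using that by (auto simp: J_def)
  \<comment> \<open>Step \<open>l\<close> changes at most an arc between \<open>v l\<close> and
    \<open>v (Suc l)\<close>. So arcs avoiding \<open>v 0, ..., v (m - 1)\<close> are as in
    \<open>F0\<close>, and the arc needed in step \<open>m\<close> is one of them.\<close>
  define arcs_ok where "arcs_ok m F \<longleftrightarrow> finite F \<and>
      (\<forall>f\<in>F. f \<in> arcs D \<and> tail D f \<notin> T \<and> (\<forall>i\<in>L - J. f \<notin> set (a i))) \<and>
      (\<forall>f. tail D f \<notin> v ` {..<m} \<longrightarrow> head D f \<notin> v ` {..<m} \<longrightarrow> (f \<in> F \<longleftrightarrow> f \<in> F0))" for m F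
  \<comment> \<open>An exchange in step \<open>l\<close> releases a root starting at
    \<open>v (Suc l)\<close>, never one at \<open>v 0\<close>; hence the index range from 1 to
    \<open>m\<close>. The last clause remembers from which earlier vertex an inserted root was seen,
    so that the absence of shortcuts can be applied to it.\<close>
  define roots_ok where "roots_ok m K \<sigma> \<longleftrightarrow> finite K \<and> K \<inter> G = {} \<and> G \<union> K \<in> \<I> \<and>
      B \<union> L \<subseteq> span (G \<union> K) \<and>
      (\<forall>j\<in>J. u j \<notin> v ` {0<..m} \<longrightarrow> j \<in> K \<and> \<sigma> j = u j) \<and>
      (\<forall>k\<in>K. \<sigma> k \<in> \<pi> k \<and> \<sigma> k \<notin> T) \<and>
      (\<forall>k\<in>K. k \<in> L \<or> k \<in> S \<and> (\<exists>l<m. v l \<in> \<pi> k))" for m K \<sigma>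
  define exc_ok where "exc_ok m F K \<sigma> \<longleftrightarrow>
      (\<forall>x. x \<notin> T \<longrightarrow> of_bool (x = v m) \<le> excess D F K \<sigma> x)" for m F and K :: "'s set" and \<sigma>
  have "\<exists>F K \<sigma>. arcs_ok m F \<and> roots_ok m K \<sigma> \<and> exc_ok m F K \<sigma>" if "m \<le> n" for m
    using that
  proof (induction m)
    case 0
    have e0J: "e0 \<notin> (\<Union>j\<in>J. set (a j))" using e0(2) JL by (auto simp: used_arcs_def)
    have "arcs_ok 0 F0"
    proof -
      have "f \<in> arcs D \<and> tail D f \<notin> T \<and> (\<forall>i\<in>L - J. f \<notin> set (a i))" if f: "f \<in> F0" for f
      proof (cases "f = e0")
        case True
        then show ?thesis using e0 by (auto simp: used_arcs_def entering_def)
      next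
        case False
        then obtain j where j: "j \<in> J" "f \<in> set (a j)" using f by (auto simp: F0_def)
        then have "f \<notin> set (a i)" if "i \<in> L - J" for i
          using disjoint_family_onD[OF a_disjoint, of i j] JL that by blast
        then show ?thesis using entry_walk_arc[OF a_walk j(2)] j(1) JL by auto
      qed
      then show ?thesis using finJ by (auto simp: arcs_ok_def F0_def)
    qed
    moreover have "roots_ok 0 J u"
    proof -
      have "G \<union> J = B \<union> L" "J \<inter> G = {}" using JL L_B by (auto simp: G_def)
      moreover have "u j \<notin> T" if "j \<in> L" for j using entry_walk_start[OF a_walk[OF that]] by blast
      ultimately show ?thesis
        using finJ indep JL u_root span_superset[of "B \<union> L"] by (auto simp: roots_ok_def)
    qed
    moreover have "exc_ok 0 F0 J u"
    proof -
      have "excess D F0 J u x = of_bool (tail D e0 = x)" if x: "x \<notin> T" for x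
      proof -
        have "head D e0 \<noteq> x" using x e0(1) by (auto simp: entering_def)
        moreover have "excess D (\<Union>j\<in>J. set (a j)) J u x = 0"
          using a_walk a_distinct JL disjoint_family_on_mono[OF JL a_disjoint] x finJ
          by (intro excess_entry_walks) auto
        ultimately show ?thesis
          unfolding F0_def using finJ e0J by (subst excess_insert_arc) auto
      qed
      then show ?thesis using v0 by (auto simp: exc_ok_def)
    qed
    ultimately show ?case by blast
  next
    case (Suc m)
    then have m: "m < n" by simp
    obtain F K \<sigma> where inv: "arcs_ok m F" "roots_ok m K \<sigma>" "exc_ok m F K \<sigma>"
      using Suc by auto
    have F_fin: "finite F"
      and F_old: "\<And>f. tail D f \<notin> v ` {..<m} \<Longrightarrow> head D f \<notin> v ` {..<m} \<Longrightarrow> f \<in> F \<longleftrightarrow> f \<in> F0"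
      using inv(1) unfolding arcs_ok_def by blast+
    have K_fin: "finite K" and K_G: "K \<inter> G = {}" and K_indep: "G \<union> K \<in> \<I>"
      and K_span: "B \<union> L \<subseteq> span (G \<union> K)"
      and K_old: "\<And>j. j \<in> J \<Longrightarrow> u j \<notin> v ` {0<..m} \<Longrightarrow> j \<in> K \<and> \<sigma> j = u j"
      and K_start: "\<And>k. k \<in> K \<Longrightarrow> \<sigma> k \<in> \<pi> k \<and> \<sigma> k \<notin> T"
      and K_origin: "\<And>k. k \<in> K \<Longrightarrow> k \<in> L \<or> k \<in> S \<and> (\<exists>l<m. v l \<in> \<pi> k)"
      using inv(2) unfolding roots_ok_def by blast+
    have exc: "\<And>x. x \<notin> T \<Longrightarrow> of_bool (x = v m) \<le> excess D F K \<sigma> x"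
      using inv(3) unfolding exc_ok_def by blast
    have new: "v m \<notin> v ` {..<m}" "v (Suc m) \<notin> v ` {..<m}" "v (Suc m) \<notin> v ` {..<Suc m}"
      using fresh m by auto
    have ne: "v m \<noteq> v (Suc m)" using inj m by simp
    have roots_mono: "roots_ok (Suc m) K \<sigma>"
    proof -
      have "v ` {0<..m} \<subseteq> v ` {0<..Suc m}" by auto
      then show ?thesis using inv(2) less_SucI unfolding roots_ok_def by blast
    qed
    have vsub: "v ` {..<m} \<subseteq> v ` {..<Suc m}" by auto
    have arcs_mono: "arcs_ok (Suc m) F"
      using inv(1) vsub unfolding arcs_ok_def by blast
    from w[OF m] consider
        (unused) f where "f \<in> arcs D" "f \<notin> used_arcs" "tail D f = v (Suc m)" "head D f = v m"
      | (used) f where "w m \<in> L" "f \<in> set (a (w m))" "tail D f = v m" "head D f = v (Suc m)"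
      | (swap) s where "w m \<in> L" "s \<in> S" "v m \<in> \<pi> s" "u (w m) = v (Suc m)"
          "s \<notin> span (B \<union> L - {w m})"
      by blast
    then show ?case
    proof cases
      case unused
      have "v 0 \<noteq> v (Suc m)" using inj m by simp
      then have "f \<notin> F0" using unused v0 JL by (auto simp: F0_def used_arcs_def)
      then have fF: "f \<notin> F" using F_old[of f] unused new by simp
      have "tail D f \<notin> T" using vT[of "Suc m"] unused m by simp
      then have "arcs_ok (Suc m) (insert f F)"
        using arcs_mono unused vsub unfolding arcs_ok_def used_arcs_def by auto
      moreover have "exc_ok (Suc m) (insert f F) K \<sigma>"
        unfolding exc_ok_def
      proof (intro allI impI)
        fix x assume "x \<notin> T"
        from exc[OF this] show "of_bool (x = v (Suc m)) \<le> excess D (insert f F) K \<sigma> x"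
          using excess_insert_arc[OF F_fin fF, of D K \<sigma> x] unused ne by (auto split: if_splits)
      qed
      ultimately show ?thesis using roots_mono by blast
    next
      case used
      then have "f \<in> F0" using wJ[OF m] by (auto simp: F0_def)
      then have fF: "f \<in> F" using F_old[of f] used new by simp
      have "arcs_ok (Suc m) (F - {f})"
        using arcs_mono used vsub unfolding arcs_ok_def by auto
      moreover have "exc_ok (Suc m) (F - {f}) K \<sigma>"
        unfolding exc_ok_def
      proof (intro allI impI)
        fix x assume "x \<notin> T"
        from exc[OF this] show "of_bool (x = v (Suc m)) \<le> excess D (F - {f}) K \<sigma> x"
          using excess_remove_arc[OF F_fin fF, of D K \<sigma> x] used ne by (auto split: if_splits)
      qed
      ultimately show ?thesis using roots_mono by blast
    next
      case swap
      let ?j = "w m"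
      have jJ: "?j \<in> J" using wJ[OF m swap(1)] .
      have "u ?j \<notin> v ` {0<..m}" using swap(4) new(3) by auto
      then have jK: "?j \<in> K" "\<sigma> ?j = u ?j" using K_old[OF jJ] by auto
      then have jG: "?j \<notin> G" using K_G by blast
      have s_span: "s \<in> span (G \<union> K)"
        using unexposed[OF m] swap(2,3) span_least[OF K_indep K_span] by (auto simp: exposed_def)
      have red_indep: "B \<union> L - {?j} \<in> \<I>" by (rule indep_subset[OF indep]) blast
      \<comment> \<open>A root inserted in an earlier step \<open>l\<close> that needed
        \<open>?j\<close> would give a residual step from \<open>v l\<close> to
        \<open>v (Suc m)\<close>, a shortcut. Therefore \<open>?j\<close> is still needed to span
        \<open>s\<close> after all earlier exchanges.\<close>
      have "G \<union> K - {?j} \<subseteq> span (B \<union> L - {?j})"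
      proof
        fix x assume x: "x \<in> G \<union> K - {?j}"
        show "x \<in> span (B \<union> L - {?j})"
        proof (cases "x \<in> B \<union> L")
          case True
          then show ?thesis using x span_superset[of "B \<union> L - {?j}"] by blast
        next
          case False
          then obtain l where l: "x \<in> S" "l < m" "v l \<in> \<pi> x" using x K_origin GL by blast
          have "\<not> residual_step (v l) (v (Suc m))" using no_shortcut[of l "Suc m"] l m by simp
          then show ?thesis
            using l swap(1,4) vT[of "Suc m"] m unfolding residual_step_def by auto
        qed
      qed
      then have s_nspan: "s \<notin> span (G \<union> K - {?j})"
        using span_least[OF red_indep] swap(5) by blast
      then have sK: "s \<notin> G \<union> K - {?j}" using span_superset[of "G \<union> K - {?j}"] by blast
      have jGK: "?j \<in> G \<union> K" using jK by blast
      let ?K = "insert s (K - {?j})" and ?\<sigma> = "\<sigma>(s := v m)"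
      have eq: "insert s (G \<union> K - {?j}) = G \<union> ?K" using jG by blast
      have GK: "G \<union> ?K \<in> \<I>" "G \<union> K \<subseteq> span (G \<union> ?K)"
        using exchange[OF K_indep jGK s_span s_nspan] unfolding eq by auto
      have "roots_ok (Suc m) ?K ?\<sigma>"
        unfolding roots_ok_def
      proof (intro conjI)
        show "?K \<inter> G = {}" using K_G sK jG by blast
        show "B \<union> L \<subseteq> span (G \<union> ?K)" using K_span span_least[OF GK] by blast
        show "\<forall>j\<in>J. u j \<notin> v ` {0<..Suc m} \<longrightarrow> j \<in> ?K \<and> ?\<sigma> j = u j"
        proof (intro ballI impI)
          fix j assume j: "j \<in> J" "u j \<notin> v ` {0<..Suc m}"
          then have "u j \<noteq> v (Suc m)" "u j \<notin> v ` {0<..m}" by auto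
          then have "j \<noteq> ?j" "j \<in> K" "\<sigma> j = u j" using K_old[OF j(1)] swap(4) by auto
          then show "j \<in> ?K \<and> ?\<sigma> j = u j" using sK by auto
        qed
        show "\<forall>k\<in>?K. ?\<sigma> k \<in> \<pi> k \<and> ?\<sigma> k \<notin> T" using K_start swap(3) vT[of m] m by auto
        show "\<forall>k\<in>?K. k \<in> L \<or> k \<in> S \<and> (\<exists>l<Suc m. v l \<in> \<pi> k)"
          using K_origin swap(2,3) less_SucI by blast
      qed (use K_fin GK in auto)
      moreover have "exc_ok (Suc m) F ?K ?\<sigma>"
        unfolding exc_ok_def
      proof (intro allI impI)
        fix x assume x: "x \<notin> T"
        have "excess D F ?K ?\<sigma> x = excess D F K \<sigma> x + of_bool (u ?j = x) - of_bool (v m = x)"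
        proof -
          have "s \<notin> K - {?j}" using sK by blast
          from excess_insert_start[OF _ this, of D F \<sigma> "v m" x] show ?thesis
            using excess_remove_start[OF K_fin jK(1), of D F \<sigma> x] K_fin jK(2) by simp
        qed
        then show "of_bool (x = v (Suc m)) \<le> excess D F ?K ?\<sigma> x"
          using exc[OF x] swap(4) ne by (auto split: if_splits)
      qed
      ultimately show ?thesis using arcs_mono by blast
    qed
  qed
  then obtain F K \<sigma> where inv: "arcs_ok n F" "roots_ok n K \<sigma>" "exc_ok n F K \<sigma>" by blast
  obtain s where s: "s \<in> S" "v n \<in> \<pi> s" "s \<notin> span (B \<union> L)" using vn by (auto simp: exposed_def)
  have K_indep: "G \<union> K \<in> \<I>" and K_span: "B \<union> L \<subseteq> span (G \<union> K)" and K_fin: "finite K"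
    and K_G: "K \<inter> G = {}" and K_start: "\<And>k. k \<in> K \<Longrightarrow> \<sigma> k \<in> \<pi> k \<and> \<sigma> k \<notin> T"
    and K_origin: "\<And>k. k \<in> K \<Longrightarrow> k \<in> L \<or> k \<in> S \<and> (\<exists>l<n. v l \<in> \<pi> k)"
    using inv(2) unfolding roots_ok_def by blast+
  \<comment> \<open>All inserted roots were seen from vertices that are not exposed, so the
    exchanges never left this span and \<open>s\<close> can still be added.\<close>
  have "G \<union> K \<subseteq> span (B \<union> L)"
  proof
    fix x assume x: "x \<in> G \<union> K"
    show "x \<in> span (B \<union> L)"
    proof (cases "x \<in> B \<union> L")
      case True
      then show ?thesis using span_superset[of "B \<union> L"] by blast
    next
      case False
      then obtain l where "x \<in> S" "l < n" "v l \<in> \<pi> x" using x K_origin GL by blast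
      then show ?thesis using unexposed by (auto simp: exposed_def)
    qed
  qed
  then have s_nspan: "s \<notin> span (G \<union> K)" using span_least[OF indep] s(3) by blast
  then have sK: "s \<notin> G \<union> K" using span_superset[of "G \<union> K"] by blast
  let ?K = "insert s K" and ?\<sigma> = "\<sigma>(s := v n)"
  have new_indep: "G \<union> ?K \<in> \<I>" using indep_insert_iff[OF K_indep s(1) sK] s_nspan by simp
  \<comment> \<open>The unit of excess at \<open>v n\<close> pays for the walk of the additional
    root \<open>s\<close>.\<close>
  have "\<exists>b. (\<forall>k\<in>?K. entry_walk D T (?\<sigma> k) (b k) \<and> set (b k) \<subseteq> F) \<and>
      disjoint_family_on (\<lambda>k. set (b k)) ?K"
  proof (rule flow_decomposition)
    show "0 \<le> excess D F ?K ?\<sigma> x" if x: "x \<notin> T" for x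
    proof -
      have "of_bool (x = v n) \<le> excess D F K \<sigma> x" using inv(3) x by (simp add: exc_ok_def)
      then show ?thesis
        using excess_insert_start[OF K_fin, of s D F \<sigma> "v n" x] sK by (auto split: if_splits)
    qed
  qed (use inv(1) K_fin K_start vT[of n] in \<open>auto simp: arcs_ok_def\<close>)
  then obtain b where b: "\<And>k. k \<in> ?K \<Longrightarrow> entry_walk D T (?\<sigma> k) (b k)"
    "\<And>k. k \<in> ?K \<Longrightarrow> set (b k) \<subseteq> F" "disjoint_family_on (\<lambda>k. set (b k)) ?K" by blast
  define c where "c k = (if k \<in> ?K then b k else a k)" for k
  define z where "z k = (if k \<in> ?K then ?\<sigma> k else u k)" for k
  have F_other: "set (a i) \<inter> F = {}" if "i \<in> L - J" for i
    using inv(1) that unfolding arcs_ok_def by blast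
  have "linkable D \<pi> (B \<union> ((L - J) \<union> ?K)) {t}"
  proof (rule linkable_entry_walks)
    show "((L - J) \<union> ?K) \<inter> B = {}" using L_B K_G sK by (auto simp: G_def)
    show "disjoint_family_on (\<lambda>k. set (c k)) ((L - J) \<union> ?K)"
      unfolding disjoint_family_on_def
    proof (intro ballI impI)
      fix k l assume kl: "k \<in> L - J \<union> ?K" "l \<in> L - J \<union> ?K" "k \<noteq> l"
      show "set (c k) \<inter> set (c l) = {}"
      proof (cases "k \<in> ?K"; cases "l \<in> ?K")
        assume "k \<in> ?K" "l \<in> ?K"
        then show ?thesis using disjoint_family_onD[OF b(3)] kl by (simp add: c_def)
      next
        assume "k \<in> ?K" "l \<notin> ?K"
        then show ?thesis using b(2)[of k] F_other[of l] kl unfolding c_def by auto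
      next
        assume "k \<notin> ?K" "l \<in> ?K"
        then show ?thesis using b(2)[of l] F_other[of k] kl unfolding c_def by auto
      next
        assume "k \<notin> ?K" "l \<notin> ?K"
        then show ?thesis using disjoint_family_onD[OF a_disjoint] kl by (simp add: c_def)
      qed
    qed
    fix k assume k: "k \<in> (L - J) \<union> ?K"
    show "z k \<in> \<pi> k" using k u_root K_start s(2) by (auto simp: z_def)
    show "entry_walk D T (z k) (c k)"
      using k a_walk b(1)[of k] unfolding z_def c_def by auto
  qed
  moreover have "B \<union> ((L - J) \<union> ?K) = G \<union> ?K" by (auto simp: G_def)
  ultimately have "linkable D \<pi> (G \<union> ?K) {t}" by simp
  moreover have "span (B \<union> L) \<subset> span (G \<union> ?K)"
  proof -
    have "span (G \<union> K) \<subseteq> span (G \<union> ?K)" by (rule span_mono) blast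
    then have "span (B \<union> L) \<subseteq> span (G \<union> ?K)" using span_least[OF K_indep K_span] by blast
    then show ?thesis using s(3) span_superset[of "G \<union> ?K"] by blast
  qed
  ultimately show ?thesis using new_indep by blast
qed

end

section \<open>From failed complementarity to the augmentation\<close>

lemma (in infinite_matroid) ex_base_of: "X \<subseteq> S \<Longrightarrow> \<exists>B. base_of \<I> X B"
  using base_extending[OF indep_empty] by blast

text \<open>Trivial paths suffice here. It puts \<open>t\<close> into the largest good set, so every
  linkage path that starts outside must enter that set.\<close>

lemma (in matroid_rooted_digraph) t_good_singleton:
  assumes "t \<in> verts D"
  shows "t_good D S \<I> \<pi> t {t}"
proof -
  obtain B where B: "base_of \<I> (rooted_in S \<pi> {t}) B" using ex_base_of[OF rooted_in_subset] by blast
  have triv: "pre_digraph.apath (D \<restriction> {t}) t [] t"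
    by (simp add: pre_digraph.apath_def pre_digraph.awalk_def pre_digraph.cas.simps
        pre_digraph.awalk_verts.simps)
  have "B \<subseteq> rooted_in S \<pi> {t}" using base_ofD(2)[OF B] .
  then show ?thesis
    unfolding t_good_def using B assms triv
    by (intro conjI exI[of _ B] exI[of _ "\<lambda>_. (t, [])"])
      (auto simp: path_from_to_unfold rooted_in_def entering_def path_arcs_def disjoint_family_on_def)
qed

lemma (in good_set) linkage_augmentable:
  assumes t: "t \<in> verts D" and largest: "\<And>X. t_good D S \<I> \<pi> t X \<Longrightarrow> X \<subseteq> T"
    and I: "I \<in> \<I>" and P: "linkage D \<pi> I {t} P"
    and not_compl: "\<not> complementarity D S \<I> \<pi> I P T"
  shows "\<exists>I'\<in>\<I>. linkable D \<pi> I' {t} \<and> span I \<subset> span I'"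
proof -
  have tT: "t \<in> T" using largest[OF t_good_singleton[OF t]] by blast
  let ?ST = "rooted_in S \<pi> T"
  have P_path: "fst (P i) \<in> \<pi> i" "apath (fst (P i)) (snd (P i)) t" if "i \<in> I" for i
    using P that by (auto simp: linkage_def path_from_to_unfold)
  have P_walk: "cas (fst (P i)) (snd (P i)) t" "set (snd (P i)) \<subseteq> arcs D" "distinct (snd (P i))"
    if "i \<in> I" for i
    using P_path(2)[OF that] distinct_verts_imp_distinct unfolding apath_def awalk_def by blast+
  have P_disjoint: "disjoint_family_on (\<lambda>i. set (snd (P i))) I"
    using P by (simp add: linkage_def path_arcs_def)
  let ?Iout = "I - ?ST"
  have "\<forall>i\<in>?Iout. \<exists>a q. snd (P i) = a @ q \<and> entry_walk D T (fst (P i)) a"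
  proof
    fix i assume i: "i \<in> ?Iout"
    then have "i \<in> S" using indep_subset_ground[OF I] by blast
    then have "fst (P i) \<notin> T" using i P_path(1)[of i] by (auto simp: rooted_in_def)
    then show "\<exists>a q. snd (P i) = a @ q \<and> entry_walk D T (fst (P i)) a"
      using ex_entry_prefix[OF P_walk(1,2) _ tT] i by blast
  qed
  then obtain a q where a: "\<And>i. i \<in> ?Iout \<Longrightarrow> snd (P i) = a i @ q i"
    "\<And>i. i \<in> ?Iout \<Longrightarrow> entry_walk D T (fst (P i)) (a i)" by metis
  have a_sub: "set (a i) \<subseteq> set (snd (P i))" if "i \<in> ?Iout" for i using a(1)[OF that] by simp
  have a_disjoint: "disjoint_family_on (\<lambda>i. set (a i)) ?Iout"
    unfolding disjoint_family_on_def
  proof (intro ballI impI)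
    fix i j assume "i \<in> ?Iout" "j \<in> ?Iout" "i \<noteq> j"
    then show "set (a i) \<inter> set (a j) = {}"
      using disjoint_family_onD[OF P_disjoint, of i j] a_sub by blast
  qed
  have B: "B \<in> \<I>" "B \<subseteq> ?ST" using base_ofD[OF B_base] by auto
  have BT: "?ST \<subseteq> span B" using base_of_spans[OF B_base rooted_in_subset] .
  have BIS: "B \<union> ?Iout \<subseteq> S" using indep_subset_ground[OF I] indep_subset_ground[OF B(1)] by blast
  \<comment> \<open>Outer roots of \<open>I\<close> may be dependent over \<open>B\<close>. A base
    containing \<open>B\<close> discards such roots without losing any of the span.\<close>
  obtain I' where I': "base_of \<I> (B \<union> ?Iout) I'" "B \<subseteq> I'"
    using base_extending[OF B(1) _ BIS] by blast
  define L where "L = I' - B"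
  have I'L: "I' = B \<union> L" using I'(2) by (auto simp: L_def)
  have LI: "L \<subseteq> ?Iout" using base_ofD(2)[OF I'(1)] by (auto simp: L_def)
  have indep: "B \<union> L \<in> \<I>" using base_ofD(1)[OF I'(1)] I'L by simp
  interpret entry_linkage D S \<I> \<pi> t T B Q L "\<lambda>i. fst (P i)" a
  proof
    show "disjoint_family_on (\<lambda>i. set (a i)) L" using disjoint_family_on_mono[OF LI a_disjoint] .
    fix j assume "j \<in> L"
    then have j: "j \<in> ?Iout" using LI by blast
    show "fst (P j) \<in> \<pi> j" "entry_walk D T (fst (P j)) (a j)" "distinct (a j)"
      using j P_path(1) a P_walk(3)[of j] by auto
  qed (use indep L_def in auto)
  have I_span: "I \<subseteq> span (B \<union> L)"
  proof
    fix i assume i: "i \<in> I"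
    show "i \<in> span (B \<union> L)"
    proof (cases "i \<in> ?ST")
      case True
      then show ?thesis using BT span_mono[of B "B \<union> L"] by blast
    next
      case False
      then show ?thesis using i base_of_spans[OF I'(1) BIS] I'L by blast
    qed
  qed
  show ?thesis
  proof (cases "span I = span (B \<union> L)")
    case False
    then have "span I \<subset> span (B \<union> L)" using span_least[OF indep I_span] by blast
    moreover have "linkable D \<pi> (B \<union> L) {t}"
      using linkable_entry_walks[OF L_B u_root a_walk a_disjoint] .
    ultimately show ?thesis using indep by blast
  next
    case True
    have "\<exists>e0\<in>entering D T. e0 \<notin> used_arcs"
    proof (rule ccontr)
      assume "\<not> ?thesis"
      then have all_used: "\<exists>j\<in>L. e = last (a j)" if "e \<in> entering D T" for e
        using that entry_walk_head_in[OF a_walk] by (fastforce simp: used_arcs_def entering_def)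
      \<comment> \<open>An entering arc on \<open>P i\<close> is the last arc of some
        \<open>a j\<close>, hence also on \<open>P j\<close>, and disjointness forces
        \<open>i = j\<close>. So paths with index outside \<open>L\<close> contain no entering arc,
        and the others only one; all four conditions rest on this.\<close>
      have owner: "i \<in> L \<and> e = last (a i)"
        if i: "i \<in> I" and e: "e \<in> set (snd (P i))" "e \<in> entering D T" for i e
      proof -
        obtain j where j: "j \<in> L" "e = last (a j)" using all_used[OF e(2)] by blast
        then have "e \<in> set (snd (P j))"
          using entry_walk_last[OF a_walk[OF j(1)]] a_sub[of j] LI by blast
        then have "i = j" using disjoint_family_onD[OF P_disjoint i, of j] j(1) LI e(1) by blast
        then show ?thesis using j by simp
      qed
      have L_eq: "L = ?Iout"
      proof
        show "?Iout \<subseteq> L"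
        proof
          fix i assume i: "i \<in> ?Iout"
          then show "i \<in> L" using owner[of i "last (a i)"] entry_walk_last[OF a(2)[OF i]] a_sub[OF i] by blast
        qed
      qed (fact LI)
      have c1: "base_of \<I> ?ST (I \<inter> ?ST)"
      proof (rule base_ofI_insert)
        show Iin: "I \<inter> ?ST \<in> \<I>" by (rule indep_subset[OF I]) blast
        fix s assume s: "s \<in> ?ST" "s \<notin> I \<inter> ?ST"
        show "insert s (I \<inter> ?ST) \<notin> \<I>"
        proof
          assume ins: "insert s (I \<inter> ?ST) \<in> \<I>"
          \<comment> \<open>Replacing \<open>B\<close> by a base that contains \<open>s\<close> and
            the inner part of \<open>I\<close> keeps the union with \<open>L\<close> independent.
            Since \<open>L\<close> is the whole outer part, \<open>insert s I\<close> would be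
            independent, although \<open>s\<close> is in \<open>span I\<close> by the equality of
            spans.\<close>
          obtain B' where B': "base_of \<I> ?ST B'" "insert s (I \<inter> ?ST) \<subseteq> B'"
            using base_extending[OF ins _ rooted_in_subset] s(1) by blast
          have "B' \<union> L \<in> \<I>"
            using base_exchange_independent[OF rooted_in_subset B_base B'(1) indep] LI by blast
          then have "insert s I \<in> \<I>" by (rule indep_subset) (use B'(2) L_eq in blast)
          moreover have "s \<in> span I" using s(1) BT span_mono[of B "B \<union> L"] True by blast
          ultimately show False
            using indep_insert_iff[OF I, of s] s rooted_in_subset by (metis IntI subsetD)
        qed
      qed blast
      have c2: "path_verts D (P i) \<subseteq> verts (D \<restriction> T) \<and> path_arcs (P i) \<subseteq> arcs (D \<restriction> T)"
        if i: "i \<in> I \<inter> ?ST" for i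
      proof -
        have "set (snd (P i)) \<inter> entering D T = {}" using owner[of i] i LI by blast
        then show ?thesis
          using walk_without_entering_arc[OF P_walk(1,2) tT, of i] P_walk(2)[of i] i
          by (auto simp: path_verts_def path_arcs_def)
      qed
      have c3: "card (path_arcs (P i) \<inter> entering D T) = 1" if i: "i \<in> ?Iout" for i
      proof -
        have "path_arcs (P i) \<inter> entering D T = {last (a i)}"
          using owner[of i] i entry_walk_last[OF a(2)[OF i]] a_sub[OF i] by (auto simp: path_arcs_def)
        then show ?thesis by simp
      qed
      have c4: "entering D T \<subseteq> (\<Union>i\<in>?Iout. path_arcs (P i))"
      proof
        fix e assume "e \<in> entering D T"
        then obtain j where j: "j \<in> L" "e = last (a j)" using all_used by blast
        then have "e \<in> path_arcs (P j)"
          using entry_walk_last[OF a_walk[OF j(1)]] a_sub[of j] LI by (auto simp: path_arcs_def)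
        then show "e \<in> (\<Union>i\<in>?Iout. path_arcs (P i))" using j LI by blast
      qed
      show False
        using not_compl c1 c2 c3 c4 unfolding complementarity_def Let_def by blast
    qed
    then obtain e0 where e0: "e0 \<in> entering D T" "e0 \<notin> used_arcs" by blast
    define R where "R = {w. residual_step\<^sup>*\<^sup>* (tail D e0) w}"
    have "\<exists>w\<in>R. exposed w"
    proof (rule ccontr)
      assume unexposed: "\<not> ?thesis"
      have "w \<in> verts D - T" if "residual_step\<^sup>*\<^sup>* (tail D e0) w" for w
        using that
      proof (induction rule: rtranclp_induct)
        case base
        then show ?case using e0(1) by (auto simp: entering_def)
      next
        case (step v w)
        have "u \<in> verts D" if "j \<in> L" "u \<in> \<pi> j" for j u
          using that root_sub indep_subset_ground[OF indep] by blast
        then show ?case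
          using step(2) u_root entry_walk_arc[OF a_walk] unfolding residual_step_def by fastforce
      qed
      then have "R \<subseteq> verts D - T" by (auto simp: R_def)
      then have "t_good D S \<I> \<pi> t (T \<union> R)"
      proof (rule t_good_residual_closed)
        show "w \<in> R" if "v \<in> R" "residual_step v w" for v w
          using that by (auto simp: R_def intro: rtranclp.rtrancl_into_rtrancl)
      qed (use unexposed in blast)
      then have "tail D e0 \<in> T" using largest by (auto simp: R_def)
      then show False using e0(1) by (simp add: entering_def)
    qed
    then show ?thesis
      using augment_along_residual_walk[OF e0] True by (auto simp: R_def)
  qed
qed

theorem mainTheorem4:
  fixes D :: "('v, 'e) pre_digraph"
    and S :: "'s set" and \<I> :: "'s set set" and \<pi> :: "'s \<Rightarrow> 'v set"
    and t :: 'v and T :: "'v set"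
    and I :: "'s set" and P :: "'s \<Rightarrow> ('v, 'e) dpath"
  assumes "matroid_rooted_digraph D S \<I> \<pi>"
    and "t \<in> verts D"
    and "largest_t_good D S \<I> \<pi> t T"
    and "I \<in> \<I>"
    and "linkage D \<pi> I {t} P"
    and "\<not> complementarity D S \<I> \<pi> I P T"
  shows "\<exists>I'\<in>\<I>. linkable D \<pi> I' {t} \<and> matroid_span S \<I> I \<subset> matroid_span S \<I> I'"
proof -
  interpret matroid_rooted_digraph D S \<I> \<pi> by fact
  have good: "t_good D S \<I> \<pi> t T" and largest: "\<And>X. t_good D S \<I> \<pi> t X \<Longrightarrow> X \<subseteq> T"
    using assms(3) unfolding largest_t_good_def by blast+
  from good obtain B Q where "T \<subseteq> verts D" "base_of \<I> (rooted_in S \<pi> T) B"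
    "\<forall>b\<in>B. path_from_to (D \<restriction> T) (\<pi> b) (Q (Inl b)) {t}"
    "\<forall>e\<in>entering D T. path_from_to (D \<restriction> T) {head D e} (Q (Inr e)) {t}"
    "disjoint_family_on (\<lambda>k. path_arcs (Q k)) (B <+> entering D T)"
    unfolding t_good_def by blast
  then interpret good_set D S \<I> \<pi> t T B Q
    by unfold_locales auto
  show ?thesis using linkage_augmentable[OF assms(2) largest assms(4-6)] .
qed

end
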